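(* Let $(X,\mathcal{C}_0,\mathcal{F},\tau)$ be a measurable locally convex space, $D$ a convex subset of $X$, $\mu$ a probability measure on $(X,\mathcal{F})$ carried by $D$ and convex-tight on $D$, $(\mu_n)_{n\ge1}$ the Cramér sequence associated with $\mu$ (with $\overline{X}_n$ of law $\mu_n$) and $s$ its entropy. For every function $f:X\to[-\infty,+\infty]$ which is measurable and concave on $D$, $$\forall n\ge1\qquad\frac1n\log\mathbb{E}\Big(e^{nf(\overline{X}_n)}\Big)\le\sup_X\,[f^\bullet\,\dot{+}\,s].$$ If, moreover, $\mathrm{dom}(f)$ is an open convex set and $f$ is upper semicontinuous on $\mathrm{dom}(f)\cap\overline{D}$, then $$\forall n\ge1\qquad\frac1n\log\mathbb{E}\Big(e^{nf(\overline{X}_n)}\Big)\le\sup_X\,[f\,\dot{+}\,s].$$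
   Context: **Measurable locally convex space.** Let $X$ be a real vector space. For a convex set $C\subset X$ containing $0$, its gauge is $M_C(x)=\inf\{t\ge0: x\in tC\}\in[0,+\infty]$. $C$ is an internal convex set if $M_C$ is finite everywhere and $C=\{x\in X: M_C(x)<1\}$. For such $C$, $\tau_C$ denotes the (not necessarily Hausdorff) locally convex topology on $X$ generated by the neighbourhoods $tC$, $t\in\mathbb{R}\setminus\{0\}$, of $0$. A measurable locally convex space is a quadruple $(X,\mathcal{C}_0,\mathcal{F},\tau)$ where $\mathcal{C}_0$ is a family of convex subsets of $X$ such that: (i) every $C\in\mathcal{C}_0$ is an internal convex set, symmetric ($C=-C$), and $\tau_C$ is separable; (ii) $\mathcal{C}_0$ is stable under finite intersections and under dilations $C\mapsto tC$, $t\ne0$; (iii) the intersection of all elements of $\mathcal{C}_0$ is $\{0\}$. Then $\tau$ is the Hausdorff locally convex topology having $\mathcal{C}_0$ as a fundamental system of neighbourhoods of $0$; $\mathcal{C}_x=\{x+C: C\in\mathcal{C}_0\}$; and $\mathcal{F}=\sigma\big(\bigcup_{x\in X}\mathcal{C}_x\big)$. Topological notions refer to $\tau$. Vector addition $X^2\to X$ is $\mathcal{F}^{\otimes2}$-$\mathcal{F}$ measurable. **Cramér sequence, entropy.** Given a probability $\mu$ on $\mathcal{F}$, let $(X_n)_{n\ge1}$ be i.i.d. with law $\mu$, $\overline{X}_n=\frac1n\sum_{k=1}^nX_k$, and $\mu_n$ the law of $\overline{X}_n$; $(\mu_n)_{n\ge1}$ is the Cramér sequence associated with $\mu$. Its entropy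 is $s:X\to[-\infty,0]$, $s(x)=\inf_{C\in\mathcal{C}_x}\liminf_{n\to\infty}\frac1n\log\mu_n(C)$. **Carried, convex-tight.** $\mu$ is carried by $D\subset X$ if for all $A,B\in\mathcal{F}$, $A\cap D=B\cap D$ implies $\mu(A)=\mu(B)$. When $\mu$ is carried by a convex $D$, the $X_n$ are taken $D$-valued. $\mu$ is convex-tight on $D$ if there is a sequence $(K_m)_{m\ge1}$ in $\mathcal{F}$ such that each $K_m\cap D$ is convex and relatively compact (contained in a compact set), and $\lim_m\mu(K_m)=1$. **Notation.** $\dot{+}$ extends addition to $[-\infty,+\infty]$ with $-\infty\,\dot{+}\,(+\infty)=+\infty$, and $0\cdot(\pm\infty)=0$. $f$ is concave on $D$ if $f(\alpha x+(1-\alpha)y)\ge\alpha f(x)\,\dot{+}\,(1-\alpha)f(y)$ for all $x,y\in D$, $\alpha\in[0,1]$. $\mathrm{dom}(f)=\{x\in X: f(x)\in\mathbb{R}\}$. $f$ is upper semicontinuous if $\{f<t\}$ is open for every $t\in[-\infty,+\infty]$; $f^\bullet$ is the smallest upper semicontinuous function on $X$ that is $\ge f$. Conventions: $e^{+\infty}=+\infty$, $e^{-\infty}=0$, $\log0=-\infty$. *)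

theory Defs
  imports "HOL-Probability.Probability"
begin

section \<open>Measurable locally convex spaces\<close>

text \<open>The real vector space is the whole type \<open>'a\<close>; it carries no type-class topology, the
  topologies below are values of type \<open>'a topology\<close>.\<close>

text \<open>The infimum is taken in the extended reals, so it is \<open>\<infinity>\<close> when no dilate contains \<open>x\<close>.\<close>

definition gauge_fun :: "'a::real_vector set \<Rightarrow> 'a \<Rightarrow> ereal"
  where "gauge_fun C x = Inf (ereal ` {t. 0 \<le> t \<and> x \<in> (*\<^sub>R) t ` C})"

definition internal_convex :: "'a::real_vector set \<Rightarrow> bool"
  where "internal_convex C \<longleftrightarrow>
    convex C \<and> 0 \<in> C \<and> (\<forall>x. gauge_fun C x < \<infinity>) \<and> C = {x. gauge_fun C x < 1}"

text \<open>Translation-invariant topology in which the finite intersections of members of \<open>N\<close> form a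
  fundamental system of neighbourhoods of \<open>0\<close>, for \<open>N\<close> as in the two uses below.\<close>

definition nhd_topology :: "'a::real_vector set set \<Rightarrow> 'a topology"
  where "nhd_topology N =
    topology (\<lambda>U. \<forall>x\<in>U. \<exists>A. finite A \<and> A \<subseteq> N \<and> (+) x ` (\<Inter>A) \<subseteq> U)"

lemma openin_nhd_topology:
  "openin (nhd_topology N) U \<longleftrightarrow> (\<forall>x\<in>U. \<exists>A. finite A \<and> A \<subseteq> N \<and> (+) x ` (\<Inter>A) \<subseteq> U)"
proof -
  have "istopology (\<lambda>U. \<forall>x\<in>U. \<exists>A. finite A \<and> A \<subseteq> N \<and> (+) x ` (\<Inter>A) \<subseteq> U)"
    unfolding istopology_def
  proof (rule conjI; intro allI impI ballI)
    fix S T x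
    assume S: "\<forall>x\<in>S. \<exists>A. finite A \<and> A \<subseteq> N \<and> (+) x ` (\<Inter>A) \<subseteq> S"
      and T: "\<forall>x\<in>T. \<exists>A. finite A \<and> A \<subseteq> N \<and> (+) x ` (\<Inter>A) \<subseteq> T"
      and x: "x \<in> S \<inter> T"
    from S x obtain A where A: "finite A" "A \<subseteq> N" "(+) x ` (\<Inter>A) \<subseteq> S"
      by (meson IntD1)
    from T x obtain B where B: "finite B" "B \<subseteq> N" "(+) x ` (\<Inter>B) \<subseteq> T"
      by (meson IntD2)
    have "(+) x ` (\<Inter>(A \<union> B)) \<subseteq> (+) x ` (\<Inter>A)" "(+) x ` (\<Inter>(A \<union> B)) \<subseteq> (+) x ` (\<Inter>B)"
      by (intro image_mono Inter_anti_mono Un_upper1 Un_upper2)+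
    then have "(+) x ` (\<Inter>(A \<union> B)) \<subseteq> S \<inter> T"
      using A(3) B(3) by (meson Int_greatest subset_trans)
    moreover have "finite (A \<union> B)" "A \<union> B \<subseteq> N" using A B by simp_all
    ultimately show "\<exists>A. finite A \<and> A \<subseteq> N \<and> (+) x ` (\<Inter>A) \<subseteq> S \<inter> T"
      by (intro exI[of _ "A \<union> B"] conjI)
  next
    fix \<K> x
    assume \<K>: "\<forall>K\<in>\<K>. \<forall>x\<in>K. \<exists>A. finite A \<and> A \<subseteq> N \<and> (+) x ` (\<Inter>A) \<subseteq> K" and x: "x \<in> \<Union>\<K>"
    from x obtain K where K: "K \<in> \<K>" "x \<in> K" by (rule UnionE)
    with \<K> obtain A where A: "finite A" "A \<subseteq> N" "(+) x ` (\<Inter>A) \<subseteq> K" by meson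
    from A(3) Union_upper[OF K(1)] have "(+) x ` (\<Inter>A) \<subseteq> \<Union>\<K>" by (rule subset_trans)
    with A show "\<exists>A. finite A \<and> A \<subseteq> N \<and> (+) x ` (\<Inter>A) \<subseteq> \<Union>\<K>"
      by (intro exI[of _ A] conjI)
  qed
  then show ?thesis
    unfolding nhd_topology_def by (subst topology_inverse') (assumption, rule refl)
qed

lemma topspace_nhd_topology [simp]: "topspace (nhd_topology N) = UNIV"
proof -
  have "openin (nhd_topology N) UNIV"
    unfolding openin_nhd_topology by (intro ballI exI[of _ "{}"]) auto
  then have "UNIV \<subseteq> topspace (nhd_topology N)" by (rule openin_subset)
  then show ?thesis by (rule top.extremum_uniqueI)
qed

text \<open>The topology \<open>\<tau>\<^sub>C\<close> of a single internal convex set.\<close>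

definition dilation_topology :: "'a::real_vector set \<Rightarrow> 'a topology"
  where "dilation_topology C = nhd_topology {(*\<^sub>R) t ` C | t. t \<noteq> 0}"

text \<open>The \<open>\<sigma>\<close>-algebra \<open>\<F>\<close> and the topology \<open>\<tau>\<close> are determined by \<open>\<C>\<^sub>0\<close>, so the quadruple is
  represented by \<open>\<C>\<^sub>0\<close> alone. A fundamental system of neighbourhoods is nonempty,
  and \<open>C0_Int\<close> gives the intersections of nonempty finite subfamilies.\<close>

locale measurable_lcs =
  fixes C0 :: "'a::real_vector set set"
  assumes C0_nonempty: "C0 \<noteq> {}"
    and C0_internal: "C \<in> C0 \<Longrightarrow> internal_convex C"
    and C0_symmetric: "C \<in> C0 \<Longrightarrow> C = uminus ` C"
    and C0_separable: "C \<in> C0 \<Longrightarrow> separable_space (dilation_topology C)"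
    and C0_Int: "B \<in> C0 \<Longrightarrow> C \<in> C0 \<Longrightarrow> B \<inter> C \<in> C0"
    and C0_dilation: "C \<in> C0 \<Longrightarrow> t \<noteq> 0 \<Longrightarrow> (*\<^sub>R) t ` C \<in> C0"
    and C0_Inter: "\<Inter>C0 = {0}"

abbreviation mlcs_topology :: "'a::real_vector set set \<Rightarrow> 'a topology"
  where "mlcs_topology \<equiv> nhd_topology"

definition convex_nhds :: "'a::real_vector set set \<Rightarrow> 'a \<Rightarrow> 'a set set"
  where "convex_nhds C0 x = (\<lambda>C. (+) x ` C) ` C0"

definition mlcs_algebra :: "'a::real_vector set set \<Rightarrow> 'a measure"
  where "mlcs_algebra C0 = sigma UNIV (\<Union>x. convex_nhds C0 x)"


section \<open>Extended exponential and logarithm\<close>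

definition exp_ereal :: "ereal \<Rightarrow> ennreal"
  where "exp_ereal x = (if x = \<infinity> then \<infinity> else if x = -\<infinity> then 0 else ennreal (exp (real_of_ereal x)))"

definition log_ennreal :: "ennreal \<Rightarrow> ereal"
  where "log_ennreal x = (if x = \<infinity> then \<infinity> else if x = 0 then -\<infinity> else ereal (ln (enn2real x)))"


section \<open>Cramer sequence and entropy\<close>

definition carried_by :: "'a measure \<Rightarrow> 'a set \<Rightarrow> bool"
  where "carried_by \<mu> D \<longleftrightarrow>
    (\<forall>A\<in>sets \<mu>. \<forall>B\<in>sets \<mu>. A \<inter> D = B \<inter> D \<longrightarrow> emeasure \<mu> A = emeasure \<mu> B)"

definition convex_tight_on :: "'a::real_vector set set \<Rightarrow> 'a measure \<Rightarrow> 'a set \<Rightarrow> bool"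
  where "convex_tight_on C0 \<mu> D \<longleftrightarrow>
    (\<exists>K :: nat \<Rightarrow> 'a set.
      (\<forall>m. K m \<in> sets \<mu> \<and> convex (K m \<inter> D) \<and>
           (\<exists>L. compactin (mlcs_topology C0) L \<and> K m \<inter> D \<subseteq> L)) \<and>
      (\<lambda>m. measure \<mu> (K m)) \<longlonglongrightarrow> 1)"

text \<open>A \<open>D\<close>-valued i.i.d. sequence \<open>(X\<^sub>k)\<^sub>k\<^sub>\<ge>\<^sub>1\<close> with law \<open>\<mu>\<close> on an arbitrary probability space \<open>P\<close>;
  \<open>D\<close> need not be measurable.\<close>

definition iid_sequence ::
    "'a::real_vector set set \<Rightarrow> 'w measure \<Rightarrow> 'a measure \<Rightarrow> 'a set \<Rightarrow> (nat \<Rightarrow> 'w \<Rightarrow> 'a) \<Rightarrow> bool"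
  where "iid_sequence C0 P \<mu> D X \<longleftrightarrow>
    prob_space P \<and>
    prob_space.indep_vars P (\<lambda>_. mlcs_algebra C0) X {1..} \<and>
    (\<forall>k\<ge>1. distr P (mlcs_algebra C0) (X k) = \<mu>) \<and>
    (\<forall>k\<ge>1. \<forall>\<omega>\<in>space P. X k \<omega> \<in> D)"

definition sample_mean :: "(nat \<Rightarrow> 'w \<Rightarrow> 'a::real_vector) \<Rightarrow> nat \<Rightarrow> 'w \<Rightarrow> 'a"
  where "sample_mean X n \<omega> = (1 / real n) *\<^sub>R (\<Sum>k=1..n. X k \<omega>)"

definition cramer_sequence ::
    "'a::real_vector set set \<Rightarrow> 'w measure \<Rightarrow> (nat \<Rightarrow> 'w \<Rightarrow> 'a) \<Rightarrow> nat \<Rightarrow> 'a measure"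
  where "cramer_sequence C0 P X n = distr P (mlcs_algebra C0) (sample_mean X n)"

definition entropy_of :: "'a::real_vector set set \<Rightarrow> (nat \<Rightarrow> 'a measure) \<Rightarrow> 'a \<Rightarrow> ereal"
  where "entropy_of C0 \<mu>s x =
    (INF C\<in>convex_nhds C0 x.
      liminf (\<lambda>n. ereal (1 / real n) * log_ennreal (emeasure (\<mu>s n) C)))"


section \<open>Extended-real-valued functions\<close>

text \<open>On type \<open>ereal\<close>, addition satisfies \<open>-\<infinity> + \<infinity> = \<infinity>\<close> and \<open>0 * \<plusminus>\<infinity> = 0\<close>, so \<open>+\<close> is the extended
  addition with the convention needed here.\<close>

lemma ereal_add_convention: "-\<infinity> + \<infinity> = (\<infinity>::ereal)" "\<infinity> + -\<infinity> = (\<infinity>::ereal)"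
  by simp_all

definition concave_ext_on :: "'a::real_vector set \<Rightarrow> ('a \<Rightarrow> ereal) \<Rightarrow> bool"
  where "concave_ext_on D f \<longleftrightarrow>
    (\<forall>x\<in>D. \<forall>y\<in>D. \<forall>\<alpha>\<in>{0..1::real}.
      f (\<alpha> *\<^sub>R x + (1 - \<alpha>) *\<^sub>R y) \<ge> ereal \<alpha> * f x + ereal (1 - \<alpha>) * f y)"

definition finite_dom :: "('a \<Rightarrow> ereal) \<Rightarrow> 'a set"
  where "finite_dom f = {x. \<bar>f x\<bar> \<noteq> \<infinity>}"

definition usc :: "'a topology \<Rightarrow> ('a \<Rightarrow> ereal) \<Rightarrow> bool"
  where "usc T f \<longleftrightarrow> (\<forall>t. openin T {x \<in> topspace T. f x < t})"

definition usc_hull :: "'a topology \<Rightarrow> ('a \<Rightarrow> ereal) \<Rightarrow> 'a \<Rightarrow> ereal"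
  where "usc_hull T f = (LEAST g. usc T g \<and> f \<le> g)"

lemma usc_hull_eq_INF:
  assumes "topspace T = UNIV"
  shows "usc_hull T f = (INF g\<in>{g. usc T g \<and> f \<le> g}. g)"
  unfolding usc_hull_def
proof (rule Least_equality)
  let ?S = "{g. usc T g \<and> f \<le> g}"
  have "openin T {x. (INF g\<in>?S. g) x < t}" for t
  proof -
    have "{x. (INF g\<in>?S. g) x < t} = (\<Union>g\<in>?S. {x. g x < t})"
      by (auto simp: INF_less_iff)
    moreover have "openin T {x. g x < t}" if "g \<in> ?S" for g
      using that assms by (simp add: usc_def)
    ultimately show ?thesis by auto
  qed
  moreover have "f \<le> (INF g\<in>?S. g)" by (rule INF_greatest) auto
  ultimately show "usc T (INF g\<in>?S. g) \<and> f \<le> (INF g\<in>?S. g)"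
    using assms by (simp add: usc_def)
next
  fix g assume "usc T g \<and> f \<le> g"
  then show "(INF g\<in>{g. usc T g \<and> f \<le> g}. g) \<le> g" by (intro INF_lower) auto
qed

end

theory Submission
  imports Defs
begin

text \<open>Concavity of \<open>f\<close> and independence of disjoint blocks make
  \<open>n \<mapsto> log E(exp(n f(X\<^sub>n)); X\<^sub>n \<in> W)\<close>, with \<open>X\<^sub>n\<close> the empirical mean, superadditive for convex \<open>W\<close>,
  so each term is bounded by its values along the multiples of \<open>n\<close>, and any factor that does not grow
  exponentially is harmless. The same argument with \<open>f = 0\<close> shows \<open>\<mu>\<^sub>n(C) \<le> exp(n b)\<close> for all \<open>n\<close> as soon as
  the exponential rate of \<open>C\<close> is below \<open>b\<close>. If \<open>W\<close> is relatively compact in \<open>D\<close>, it is covered by finitely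
  many convex neighbourhoods on each of which \<open>f \<le> a\<close> and \<open>s < b\<close> with \<open>a + b\<close> close to the supremum, which
  gives the bound up to the number of neighbourhoods. Convex-tightness removes \<open>W\<close>.\<close>

section \<open>Dilations of internal convex sets\<close>

text \<open>The bound concerns each fixed \<open>n\<close>, while the entropy controls only a
  \<open>liminf\<close>: a small rate may show along a subsequence that contains no multiples of the
  given index. The strict inequality in \<open>gauge_fun C x < 1\<close> resolves this. Every point
  of \<open>C\<close> lies in a smaller dilate, so blocks can be required to land in
  \<open>r C\<close> with \<open>r < 1\<close> at an arbitrarily small loss of probability, and the
  slack \<open>1 - r\<close> absorbs the leftover vectors. Two more obstacles shape the text.
  \<open>D\<close> need not be measurable, so \<open>f\<close> is replaced by a measurable function
  that agrees with it on \<open>D\<close>, and concavity is invoked only at means, which lie in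
  \<open>D\<close>. The supremum may be infinite, so every estimate is made against a real
  \<open>r\<close> strictly above it; the strictness also leaves room for real \<open>a\<close> and
  \<open>b\<close>.\<close>

lemma dilate_add:
  fixes C :: "'a::real_vector set"
  assumes "convex C" "0 \<le> a" "0 \<le> b" "x \<in> (*\<^sub>R) a ` C" "y \<in> (*\<^sub>R) b ` C"
  shows "x + y \<in> (*\<^sub>R) (a + b) ` C"
proof -
  obtain c d where cd: "c \<in> C" "d \<in> C" "x = a *\<^sub>R c" "y = b *\<^sub>R d" using assms by auto
  show ?thesis
  proof (cases "a + b = 0")
    case True
    then have "a = 0" "b = 0" using assms by auto
    then show ?thesis using cd by auto
  next
    case False
    let ?e = "(a / (a+b)) *\<^sub>R c + (b / (a+b)) *\<^sub>R d"
    have "?e \<in> C"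
      using assms cd False by (intro convexD) (auto simp: add_divide_distrib[symmetric])
    moreover have "x + y = (a+b) *\<^sub>R ?e"
      using False cd by (simp add: scaleR_add_right)
    ultimately show ?thesis by blast
  qed
qed

lemma dilate_mono:
  fixes C :: "'a::real_vector set"
  assumes "convex C" "0 \<in> C" "0 \<le> a" "a \<le> b" "x \<in> (*\<^sub>R) a ` C"
  shows "x \<in> (*\<^sub>R) b ` C"
proof -
  have "0 \<in> (*\<^sub>R) (b - a) ` C" using assms(2) by (intro image_eqI[of _ _ 0]) auto
  from dilate_add[OF assms(1,3) _ assms(5) this] assms(4) show ?thesis by auto
qed

lemma dilate_dilate: "(x::'a::real_vector) \<in> (*\<^sub>R) a ` C \<Longrightarrow> b *\<^sub>R x \<in> (*\<^sub>R) (b * a) ` C"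
  by auto

lemma translate_mem_iff: "(y::'a::real_vector) \<in> (+) x ` A \<longleftrightarrow> y - x \<in> A"
  by (auto intro!: image_eqI[of _ _ "y - x"])

lemma internal_convexD:
  assumes "internal_convex C"
  shows "convex C" "0 \<in> C" "gauge_fun C x < \<infinity>" "x \<in> C \<Longrightarrow> gauge_fun C x < 1"
  using assms unfolding internal_convex_def by blast+

lemma internal_convex_absorbing:
  assumes C: "internal_convex C"
  shows "\<exists>t>0. x \<in> (*\<^sub>R) t ` C"
proof -
  obtain t where t: "0 \<le> t" "x \<in> (*\<^sub>R) t ` C"
    using internal_convexD(3)[OF C] unfolding gauge_fun_def Inf_less_iff by blast
  have "x \<in> (*\<^sub>R) (t + 1) ` C"
    using dilate_mono[OF internal_convexD(1,2)[OF C] t(1) _ t(2)] by simp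
  then show ?thesis using \<open>0 \<le> t\<close> by (intro exI[of _ "t+1"]) auto
qed

text \<open>Openness in terms of dilates: \<open>C\<close> consists of the points of gauge strictly
  below \<open>1\<close>, so a point of a dilate has room to spare. Openness of translates,
  measurability of addition and the continuity argument for probabilities rest on this.\<close>

lemma internal_convex_shrink:
  assumes C: "internal_convex C" and "0 < a" "x \<in> (*\<^sub>R) a ` C"
  shows "\<exists>b. 0 < b \<and> b < a \<and> x \<in> (*\<^sub>R) b ` C"
proof -
  obtain c where c: "c \<in> C" "x = a *\<^sub>R c" using assms by auto
  obtain t where t: "0 \<le> t" "t < 1" "c \<in> (*\<^sub>R) t ` C"
    using internal_convexD(4)[OF C c(1)] unfolding gauge_fun_def Inf_less_iff by auto
  \<comment> \<open>The factor \<open>t\<close> may be \<open>0\<close>; its midpoint with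
    \<open>1\<close> is positive and still below \<open>1\<close>.\<close>
  have "c \<in> (*\<^sub>R) ((t + 1) / 2) ` C"
    using dilate_mono[OF internal_convexD(1,2)[OF C] t(1) _ t(3)] t(2) by simp
  from dilate_dilate[OF this, of a] c(2) show ?thesis
    using t \<open>0 < a\<close> by (intro exI[of _ "a * ((t+1)/2)"]) auto
qed

section \<open>Arithmetic of the neighbourhoods in \<open>C0\<close> and the topology they
  generate\<close>

context measurable_lcs
begin

lemma C0_convex: "C \<in> C0 \<Longrightarrow> convex C" and C0_zero: "C \<in> C0 \<Longrightarrow> 0 \<in> C"
  using C0_internal internal_convexD(1,2) by blast+

lemma C0_dilate_minus:
  assumes "C \<in> C0" "x \<in> (*\<^sub>R) a ` C"
  shows "- x \<in> (*\<^sub>R) a ` C"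
proof -
  obtain c where "c \<in> C" "x = a *\<^sub>R c" using assms by auto
  moreover have "- c \<in> C" using C0_symmetric[OF assms(1)] \<open>c \<in> C\<close> by blast
  ultimately show ?thesis by (intro image_eqI[of _ _ "- c"]) auto
qed

lemmas C0_dilate_add = dilate_add[OF C0_convex]
lemmas C0_dilate_mono = dilate_mono[OF C0_convex C0_zero]
lemmas C0_absorbing = internal_convex_absorbing[OF C0_internal]
lemmas C0_shrink = internal_convex_shrink[OF C0_internal]

lemma C0_shrink1: "C \<in> C0 \<Longrightarrow> x \<in> C \<Longrightarrow> \<exists>b. 0 < b \<and> b < 1 \<and> x \<in> (*\<^sub>R) b ` C"
  using C0_shrink[of C 1 x] by simp

lemma C0_small:
  assumes "C \<in> C0"
  shows "\<exists>e>0. \<forall>t. 0 \<le> t \<and> t \<le> e \<longrightarrow> t *\<^sub>R x \<in> C"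
proof -
  obtain u where u: "0 < u" "x \<in> (*\<^sub>R) u ` C" using C0_absorbing[OF assms] by blast
  have "t *\<^sub>R x \<in> C" if "0 \<le> t" "t \<le> 1/u" for t
  proof -
    have "t *\<^sub>R x \<in> (*\<^sub>R) (t * u) ` C" using dilate_dilate[OF u(2)] .
    then have "t *\<^sub>R x \<in> (*\<^sub>R) 1 ` C"
      using that u by (elim C0_dilate_mono[OF assms assms, rotated -1]) (auto simp: field_simps)
    then show ?thesis by simp
  qed
  then show ?thesis using u by (intro exI[of _ "1/u"]) auto
qed

text \<open>Lets a single member of \<open>C0\<close> replace the finite subfamilies in
  \<open>nhd_topology\<close>. The empty subfamily is where \<open>C0_nonempty\<close>
  enters.\<close>

lemma C0_finite_Inter:
  assumes "finite A" "A \<subseteq> C0"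
  shows "\<exists>C\<in>C0. C \<subseteq> \<Inter>A"
  using assms
proof (induction A)
  case empty
  then show ?case using C0_nonempty by auto
next
  case (insert B A)
  then obtain C where "C \<in> C0" "C \<subseteq> \<Inter>A" by auto
  then show ?case using insert.prems C0_Int by (intro bexI[of _ "B \<inter> C"]) auto
qed

lemma openin_mlcs_iff:
  "openin (mlcs_topology C0) U \<longleftrightarrow> (\<forall>x\<in>U. \<exists>C\<in>C0. (+) x ` C \<subseteq> U)"
proof -
  have "(\<exists>A. finite A \<and> A \<subseteq> C0 \<and> (+) x ` (\<Inter>A) \<subseteq> U) \<longleftrightarrow> (\<exists>C\<in>C0. (+) x ` C \<subseteq> U)" for x
  proof
    assume "\<exists>A. finite A \<and> A \<subseteq> C0 \<and> (+) x ` (\<Inter>A) \<subseteq> U"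
    then obtain A where A: "finite A" "A \<subseteq> C0" "(+) x ` (\<Inter>A) \<subseteq> U" by auto
    from C0_finite_Inter[OF A(1,2)] obtain C where "C \<in> C0" "C \<subseteq> \<Inter>A" by auto
    with A(3) show "\<exists>C\<in>C0. (+) x ` C \<subseteq> U" by (meson image_mono subset_trans)
  next
    assume "\<exists>C\<in>C0. (+) x ` C \<subseteq> U"
    then obtain C where "C \<in> C0" "(+) x ` C \<subseteq> U" by auto
    then show "\<exists>A. finite A \<and> A \<subseteq> C0 \<and> (+) x ` (\<Inter>A) \<subseteq> U"
      by (intro exI[of _ "{C}"]) auto
  qed
  then show ?thesis unfolding openin_nhd_topology by simp
qed

lemma C0_translate_mem:
  assumes C: "C \<in> C0" and ab: "0 \<le> a" "0 \<le> b" and "y - x \<in> (*\<^sub>R) a ` C" "z - y \<in> (*\<^sub>R) b ` C"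
  shows "z - x \<in> (*\<^sub>R) (a + b) ` C"
  using C0_dilate_add[OF C ab assms(4,5)] by (simp add: algebra_simps)

lemma openin_translate:
  assumes C: "C \<in> C0"
  shows "openin (mlcs_topology C0) ((+) x ` C)"
  unfolding openin_mlcs_iff
proof
  fix y assume "y \<in> (+) x ` C"
  then have "y - x \<in> C" by (simp add: translate_mem_iff)
  then obtain b where b: "0 < b" "b < 1" "y - x \<in> (*\<^sub>R) b ` C" using C0_shrink1[OF C] by blast
  have "(+) y ` (*\<^sub>R) (1 - b) ` C \<subseteq> (+) x ` C"
  proof
    fix z assume "z \<in> (+) y ` (*\<^sub>R) (1 - b) ` C"
    then have zy: "z - y \<in> (*\<^sub>R) (1 - b) ` C" by (simp add: translate_mem_iff)
    have "z - x \<in> (*\<^sub>R) (b + (1 - b)) ` C"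
      using b by (intro C0_translate_mem[OF C _ _ b(3) zy]) auto
    then show "z \<in> (+) x ` C" by (simp add: translate_mem_iff)
  qed
  moreover have "(*\<^sub>R) (1 - b) ` C \<in> C0" using C0_dilation[OF C] b by simp
  ultimately show "\<exists>B\<in>C0. (+) y ` B \<subseteq> (+) x ` C" by blast
qed

section \<open>Measurability\<close>

text \<open>Gauge balls are open for \<open>\<tau>\<^sub>C\<close>, because a point of a ball has
  room to spare, so a countable dense set meets each of them. Separability is used below only in
  this metric form.\<close>

lemma C0_countable_dense:
  assumes C: "C \<in> C0"
  obtains S where "countable S" "\<And>x e. 0 < e \<Longrightarrow> \<exists>s\<in>S. s - x \<in> (*\<^sub>R) e ` C"
proof -
  let ?T = "dilation_topology C"
  have top: "topspace ?T = UNIV" by (simp add: dilation_topology_def)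
  from C0_separable[OF C] obtain S where S: "countable S" "?T closure_of S = topspace ?T"
    unfolding separable_space_def by auto
  have "\<exists>s\<in>S. s - x \<in> (*\<^sub>R) e ` C" if e: "0 < e" for x e
  proof -
    define U where "U = {y. y - x \<in> (*\<^sub>R) e ` C}"
    have "openin ?T U"
      unfolding dilation_topology_def openin_nhd_topology
    proof
      fix y assume "y \<in> U"
      then have "y - x \<in> (*\<^sub>R) e ` C" by (simp add: U_def)
      then obtain b where b: "0 < b" "b < e" "y - x \<in> (*\<^sub>R) b ` C"
        using C0_shrink[OF C e] by blast
      have "(+) y ` (*\<^sub>R) (e - b) ` C \<subseteq> U"
      proof
        fix z assume "z \<in> (+) y ` (*\<^sub>R) (e - b) ` C"
        then have zy: "z - y \<in> (*\<^sub>R) (e - b) ` C" by (simp add: translate_mem_iff)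
        have "z - x \<in> (*\<^sub>R) (b + (e - b)) ` C"
          using b by (intro C0_translate_mem[OF C _ _ b(3) zy]) auto
        then show "z \<in> U" by (simp add: U_def)
      qed
      then show "\<exists>A. finite A \<and> A \<subseteq> {(*\<^sub>R) t ` C |t. t \<noteq> 0} \<and> (+) y ` \<Inter> A \<subseteq> U"
        using b by (intro exI[of _ "{(*\<^sub>R) (e - b) ` C}"]) auto
    qed
    moreover have "x \<in> U" using C0_zero[OF C] by (auto simp: U_def intro!: image_eqI[of _ _ 0])
    moreover have "x \<in> ?T closure_of S" using S top by simp
    ultimately have "\<exists>s. s \<in> S \<and> s \<in> U" unfolding in_closure_of by blast
    then show ?thesis by (simp add: U_def Bex_def)
  qed
  with S(1) show ?thesis by (rule that)
qed

lemma space_mlcs [simp]: "space (mlcs_algebra C0) = UNIV"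
  by (simp add: mlcs_algebra_def)

lemma sets_translate:
  assumes "C \<in> C0"
  shows "(+) x ` C \<in> sets (mlcs_algebra C0)"
  using assms unfolding mlcs_algebra_def by (subst sets_measure_of) (auto simp: convex_nhds_def)

lemma sets_ball:
  assumes "C \<in> C0" "e \<noteq> 0"
  shows "{y. y - x \<in> (*\<^sub>R) e ` C} \<in> sets (mlcs_algebra C0)"
proof -
  have "{y. y - x \<in> (*\<^sub>R) e ` C} = (+) x ` (*\<^sub>R) e ` C" by (auto simp: translate_mem_iff)
  then show ?thesis using sets_translate[OF C0_dilation[OF assms]] by simp
qed

lemma measurable_mlcsI:
  assumes "\<And>x C. C \<in> C0 \<Longrightarrow> {w \<in> space M. g w - x \<in> C} \<in> sets M"
  shows "g \<in> measurable M (mlcs_algebra C0)"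
  unfolding mlcs_algebra_def
proof (rule measurable_measure_of)
  fix A assume "A \<in> (\<Union>x. convex_nhds C0 x)"
  then obtain x C where "C \<in> C0" "A = (+) x ` C" by (auto simp: convex_nhds_def)
  then have "g -` A \<inter> space M = {w \<in> space M. g w - x \<in> C}" by (auto simp: translate_mem_iff)
  then show "g -` A \<inter> space M \<in> sets M" using assms \<open>C \<in> C0\<close> by simp
qed auto

text \<open>The offset \<open>2\<close> keeps these numbers below \<open>1\<close> even for
  \<open>n = 0\<close>, so that \<open>1 - 1 / (real n + 2)\<close> is also an admissible dilation
  factor.\<close>

lemma archimedean_step:
  assumes "0 < (e::real)"
  obtains n :: nat where "1 / (real n + 2) < e"
proof -
  obtain n :: nat where n: "1 / real (Suc n) < e"
    using assms nat_approx_posE by blast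
  have "1 / (real n + 2) \<le> 1 / real (Suc n)" by (intro divide_left_mono) auto
  with n show ?thesis by (intro that[of n]) linarith
qed

text \<open>The topology \<open>\<tau>\<^sub>C\<close> is separable and pseudometrizable, hence hereditarily Lindelof.\<close>

lemma sets_dilation_open:
  assumes C: "C \<in> C0" and U: "\<And>x. x \<in> U \<Longrightarrow> \<exists>e>0. (+) x ` (*\<^sub>R) e ` C \<subseteq> U"
  shows "U \<in> sets (mlcs_algebra C0)"
proof -
  from C0_countable_dense[OF C] obtain S where
    S: "countable S" "\<And>x e. 0 < e \<Longrightarrow> \<exists>s\<in>S. s - x \<in> (*\<^sub>R) e ` C" by metis
  define r where "r n = 1 / (real n + 2)" for n :: nat
  have r: "0 < r n" for n by (simp add: r_def)
  define B where "B p = {y. y - fst p \<in> (*\<^sub>R) (r (snd p)) ` C}" for p :: "'a \<times> nat"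
  define I where "I = {p \<in> S \<times> UNIV. B p \<subseteq> U}"
  have "U \<subseteq> (\<Union>p\<in>I. B p)"
  proof
    fix x assume "x \<in> U"
    then obtain e where e: "e > 0" "(+) x ` (*\<^sub>R) e ` C \<subseteq> U" using U by blast
    \<comment> \<open>The ball of radius \<open>r n\<close> around a centre \<open>s\<close> that is
      \<open>r n\<close>-close to \<open>x\<close> stays within \<open>2 * r n\<close> of
      \<open>x\<close>, hence half of \<open>e\<close>.\<close>
    obtain n :: nat where n: "r n < e / 2"
      using e(1) archimedean_step[of "e/2"] unfolding r_def by auto
    obtain s where s: "s \<in> S" "s - x \<in> (*\<^sub>R) (r n) ` C" using S(2)[OF r] by blast
    have "y \<in> U" if y: "y - s \<in> (*\<^sub>R) (r n) ` C" for y
    proof -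
      have "y - x \<in> (*\<^sub>R) (r n + r n) ` C"
        using C0_translate_mem[OF C less_imp_le[OF r] less_imp_le[OF r] s(2) y] .
      then have "y - x \<in> (*\<^sub>R) e ` C"
        using n r[of n] by (elim C0_dilate_mono[OF C C, rotated -1]) auto
      then have "y \<in> (+) x ` (*\<^sub>R) e ` C" unfolding translate_mem_iff .
      then show ?thesis using e(2) by (rule rev_subsetD)
    qed
    then have "(s, n) \<in> I" using s by (simp add: I_def B_def subset_iff)
    moreover have "x - s \<in> (*\<^sub>R) (r n) ` C" using C0_dilate_minus[OF C s(2)] by simp
    then have "x \<in> B (s, n)" by (simp add: B_def)
    ultimately show "x \<in> (\<Union>p\<in>I. B p)" by blast
  qed
  moreover have "(\<Union>p\<in>I. B p) \<subseteq> U" by (auto simp: I_def)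
  moreover have "countable I" unfolding I_def
    using S(1) by (auto intro: countable_subset[of _ "S \<times> UNIV"])
  moreover have "B p \<in> sets (mlcs_algebra C0)" for p
    unfolding B_def using r[of "snd p"] by (intro sets_ball[OF C]) simp
  ultimately show ?thesis
    using sets.countable_UN''[of I B "mlcs_algebra C0"] by (metis subset_antisym)
qed

text \<open>Continuity of addition is not enough for the product algebra: the preimage of
  \<open>z + C\<close> must be a countable union of measurable rectangles. The separability of
  \<open>\<tau>\<^sub>C\<close> supplies the countably many centres.\<close>

lemma measurable_add:
  "(\<lambda>(x, y). x + y) \<in> measurable (mlcs_algebra C0 \<Otimes>\<^sub>M mlcs_algebra C0) (mlcs_algebra C0)"
proof (rule measurable_mlcsI)
  fix z C assume C: "C \<in> C0"
  let ?F = "mlcs_algebra C0"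
  from C0_countable_dense[OF C] obtain S where
    S: "countable S" "\<And>x e. 0 < e \<Longrightarrow> \<exists>s\<in>S. s - x \<in> (*\<^sub>R) e ` C" by metis
  define r where "r n = 1 / (real n + 2)" for n :: nat
  have r: "0 < r n" "r n < 1" for n by (simp_all add: r_def)
  \<comment> \<open>The two centres add up to \<open>z\<close> and the two radii to
    \<open>1\<close>, so sums of points of the two sides lie in \<open>z + C\<close>.\<close>
  define B where "B p = {x. x - fst p \<in> (*\<^sub>R) (r (snd p)) ` C}
               \<times> {y. y - (z - fst p) \<in> (*\<^sub>R) (1 - r (snd p)) ` C}" for p :: "'a \<times> nat"
  define I where "I = S \<times> (UNIV :: nat set)"
  have "{w. (case w of (x, y) \<Rightarrow> x + y) - z \<in> C} = (\<Union>p\<in>I. B p)"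
  proof (intro equalityI subsetI)
    fix w assume w: "w \<in> {w. (case w of (x, y) \<Rightarrow> x + y) - z \<in> C}"
    obtain x y where xy: "w = (x, y)" by fastforce
    with w have "x + y - z \<in> C" by simp
    then obtain b where b: "0 < b" "b < 1" "x + y - z \<in> (*\<^sub>R) b ` C" using C0_shrink1[OF C] by blast
    \<comment> \<open>Moving from \<open>x\<close> to \<open>s\<close> costs \<open>r n\<close>, and
      the second side only offers radius \<open>1 - r n\<close>, so
      \<open>b + 2 * r n \<le> 1\<close> is required.\<close>
    obtain n :: nat where n: "r n < (1 - b) / 2"
      using b archimedean_step[of "(1-b)/2"] unfolding r_def by auto
    obtain s where s: "s \<in> S" "s - x \<in> (*\<^sub>R) (r n) ` C" using S(2)[OF r(1)] by blast
    have "x - s \<in> (*\<^sub>R) (r n) ` C" using C0_dilate_minus[OF C s(2)] by simp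
    moreover have "(x + y - z) + (s - x) \<in> (*\<^sub>R) (b + r n) ` C"
      using C0_dilate_add[OF C _ _ b(3) s(2)] b(1) r(1)[of n] by simp
    then have "y - (z - s) \<in> (*\<^sub>R) (b + r n) ` C" by (simp add: algebra_simps)
    then have "y - (z - s) \<in> (*\<^sub>R) (1 - r n) ` C"
      using b(1) n r(1)[of n] by (elim C0_dilate_mono[OF C C, rotated -1]) auto
    ultimately have "w \<in> B (s, n)" using xy by (simp add: B_def)
    then show "w \<in> (\<Union>p\<in>I. B p)" using s(1) by (auto simp: I_def simp del: split_paired_Ex)
  next
    fix w assume "w \<in> (\<Union>p\<in>I. B p)"
    then obtain p where "w \<in> B p" by blast
    then obtain x y where w: "w = (x, y)" "x - fst p \<in> (*\<^sub>R) (r (snd p)) ` C"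
      "y - (z - fst p) \<in> (*\<^sub>R) (1 - r (snd p)) ` C" unfolding B_def by blast
    have "(x - fst p) + (y - (z - fst p)) \<in> (*\<^sub>R) (r (snd p) + (1 - r (snd p))) ` C"
      using r[of "snd p"] by (intro C0_dilate_add[OF C _ _ w(2,3)]) auto
    then show "w \<in> {w. (case w of (x, y) \<Rightarrow> x + y) - z \<in> C}"
      using w(1) by (simp add: algebra_simps)
  qed
  moreover have "B p \<in> sets (?F \<Otimes>\<^sub>M ?F)" for p
    unfolding B_def using r[of "snd p"] by (intro pair_measureI sets_ball[OF C]) auto
  moreover have "countable I" using S(1) by (auto simp: I_def)
  moreover have "space (?F \<Otimes>\<^sub>M ?F) = UNIV" by (simp add: space_pair_measure)
  ultimately show "{w \<in> space (?F \<Otimes>\<^sub>M ?F). (case w of (x, y) \<Rightarrow> x + y) - z \<in> C}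
      \<in> sets (?F \<Otimes>\<^sub>M ?F)"
    using sets.countable_UN''[of I B "?F \<Otimes>\<^sub>M ?F"] by auto
qed

lemma measurable_affine: "(\<lambda>y. c *\<^sub>R y + x) \<in> measurable (mlcs_algebra C0) (mlcs_algebra C0)"
proof (cases "c = 0")
  case True
  then show ?thesis by simp
next
  case False
  show ?thesis
  proof (rule measurable_mlcsI)
    fix z C assume C: "C \<in> C0"
    define u where "u = (1/c) *\<^sub>R (z - x)"
    have "c *\<^sub>R y + x - z = c *\<^sub>R (y - u)" for y
      using False by (simp add: scaleR_diff_right u_def)
    moreover have "c *\<^sub>R v \<in> C \<longleftrightarrow> v \<in> (*\<^sub>R) (1/c) ` C" for v
    proof
      assume "c *\<^sub>R v \<in> C"
      then show "v \<in> (*\<^sub>R) (1/c) ` C" using False by (intro image_eqI[of _ _ "c *\<^sub>R v"]) auto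
    next
      assume "v \<in> (*\<^sub>R) (1/c) ` C"
      then show "c *\<^sub>R v \<in> C" using False by auto
    qed
    ultimately have "{y. c *\<^sub>R y + x - z \<in> C} = {y. y - u \<in> (*\<^sub>R) (1/c) ` C}" by simp
    then show "{y \<in> space (mlcs_algebra C0). c *\<^sub>R y + x - z \<in> C} \<in> sets (mlcs_algebra C0)"
      using sets_ball[OF C, of "1/c"] False by simp
  qed
qed

section \<open>Segments in open sets and measurability of open convex sets\<close>

lemma open_segment_extend:
  assumes "openin (mlcs_topology C0) U" "y \<in> U"
  shows "\<exists>e>0. \<forall>t. 0 \<le> t \<and> t \<le> e \<longrightarrow> y + t *\<^sub>R v \<in> U"
proof -
  obtain C where C: "C \<in> C0" "(+) y ` C \<subseteq> U" using assms openin_mlcs_iff by blast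
  then show ?thesis using C0_small[OF C(1), of v] by blast
qed

text \<open>Sets open for a single \<open>\<tau>\<^sub>C\<close> are measurable, and a convex open
  \<open>U\<close> containing \<open>x + C\<close> is of this kind. Given \<open>y\<close> in
  \<open>U\<close>, a point \<open>y + d (y - x)\<close> slightly beyond \<open>y\<close> is still
  in \<open>U\<close>; combining it with \<open>x + C\<close> in the weights
  \<open>1 / (1 + d)\<close> and \<open>d / (1 + d)\<close> gives a dilate of \<open>C\<close>
  around \<open>y\<close> inside \<open>U\<close>. This applies to \<open>dom f\<close>.\<close>

lemma sets_open_convex:
  assumes U: "openin (mlcs_topology C0) U" "convex U"
  shows "U \<in> sets (mlcs_algebra C0)"
proof (cases "U = {}")
  case False
  then obtain x where x: "x \<in> U" by auto
  obtain C where C: "C \<in> C0" "(+) x ` C \<subseteq> U" using U(1) x openin_mlcs_iff by blast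
  show ?thesis
  proof (rule sets_dilation_open[OF C(1)])
    fix y assume y: "y \<in> U"
    obtain d where d: "d > 0" "y + d *\<^sub>R (y - x) \<in> U"
      using open_segment_extend[OF U(1) y, of "y - x"] by (meson order_refl less_imp_le)
    have "y + (d / (1 + d)) *\<^sub>R c \<in> U" if "c \<in> C" for c
    proof -
      have "(1 / (1 + d)) *\<^sub>R (y + d *\<^sub>R (y - x)) + (d / (1 + d)) *\<^sub>R (x + c) \<in> U"
        using d that C by (intro convexD[OF U(2)]) (auto simp: add_divide_distrib[symmetric])
      moreover have "(1 / (1 + d)) *\<^sub>R (y + d *\<^sub>R (y - x)) + (d / (1 + d)) *\<^sub>R (x + c)
        = (1 / (1 + d) + d / (1 + d)) *\<^sub>R y + (d / (1 + d)) *\<^sub>R c"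
        by (simp add: algebra_simps)
      moreover have "1 / (1 + d) + d / (1 + d) = 1"
        using d by (simp add: add_divide_distrib[symmetric])
      ultimately show ?thesis by simp
    qed
    then show "\<exists>e>0. (+) y ` (*\<^sub>R) e ` C \<subseteq> U"
      using d by (intro exI[of _ "d / (1 + d)"]) auto
  qed
qed simp

end

lemma (in measurable_lcs) measurable_sum_mlcs:
  assumes "finite B" "\<And>i. i \<in> B \<Longrightarrow> h i \<in> measurable M (mlcs_algebra C0)"
  shows "(\<lambda>w. \<Sum>i\<in>B. h i w) \<in> measurable M (mlcs_algebra C0)"
  using assms
proof (induction B)
  case empty
  then show ?case by simp
next
  case (insert j B)
  have "(\<lambda>w. (h j w, \<Sum>i\<in>B. h i w)) \<in> measurable M (mlcs_algebra C0 \<Otimes>\<^sub>M mlcs_algebra C0)"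
    using insert by (intro measurable_Pair) auto
  from measurable_compose[OF this measurable_add] insert.hyps show ?case by simp
qed

section \<open>Sums of independent identically distributed vectors\<close>

locale iid_lcs = measurable_lcs C0 + prob_space P
  for C0 :: "'a::real_vector set set" and P :: "'w measure" +
  fixes X :: "nat \<Rightarrow> 'w \<Rightarrow> 'a" and \<mu> :: "'a measure" and D :: "'a set"
  assumes indep: "indep_vars (\<lambda>_. mlcs_algebra C0) X {1..}"
    and law: "1 \<le> k \<Longrightarrow> distr P (mlcs_algebra C0) (X k) = \<mu>"
    and X_in: "1 \<le> k \<Longrightarrow> \<omega> \<in> space P \<Longrightarrow> X k \<omega> \<in> D"
    and convex_D: "convex D"
begin

abbreviation F :: "'a measure" where "F \<equiv> mlcs_algebra C0"

text \<open>The half-open range makes \<open>block 0 n\<close> and \<open>block n (n + k)\<close>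
  disjoint with union \<open>block 0 (n + k)\<close>, and it never reaches the index
  \<open>0\<close>, about which nothing is assumed. Sums, unlike means, simply add.\<close>

definition block :: "nat \<Rightarrow> nat \<Rightarrow> 'w \<Rightarrow> 'a"
  where "block a b \<omega> = (\<Sum>i\<in>{a<..b}. X i \<omega>)"

lemma measurable_X: "1 \<le> k \<Longrightarrow> X k \<in> measurable P F"
  using indep unfolding indep_vars_def2 by simp

lemma measurable_block [measurable]: "block a b \<in> measurable P F"
  unfolding block_def[abs_def] by (intro measurable_sum_mlcs measurable_X) auto

lemma block_add: "block 0 (n + k) \<omega> = block 0 n \<omega> + block n (n + k) \<omega>"
  unfolding block_def by (subst sum.union_disjoint[symmetric]) (auto intro!: sum.cong)

lemma block_Suc: "block a (a + Suc k) \<omega> = block a (a + k) \<omega> + X (Suc (a + k)) \<omega>"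
proof -
  have "{a<..a + Suc k} = insert (Suc (a + k)) {a<..a + k}" by auto
  then show ?thesis by (simp add: block_def add.commute)
qed

lemma indep_sums:
  assumes "finite A" "finite B" "A \<inter> B = {}" "0 \<notin> A" "0 \<notin> B"
  shows "indep_var F (\<lambda>\<omega>. \<Sum>i\<in>A. X i \<omega>) F (\<lambda>\<omega>. \<Sum>i\<in>B. X i \<omega>)"
proof -
  have meas: "(\<lambda>x. \<Sum>i\<in>K. x i) \<in> measurable (PiM K (\<lambda>_. F)) F" if "finite K" for K :: "nat set"
    using that by (intro measurable_sum_mlcs measurable_component_singleton)
  have sub: "A \<subseteq> {1..}" "B \<subseteq> {1..}" using assms(4,5) by (metis atLeast_iff less_one linorder_not_less subsetI)+
  from indep_var_compose[OF indep_var_restrict[OF indep assms(3) sub] meas[OF assms(1)] meas[OF assms(2)]]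
  show ?thesis by (simp add: comp_def cong: sum.cong)
qed

lemma indep_blocks: "indep_var F (block 0 n) F (block n (n + k))"
  using indep_sums[of "{0<..n}" "{n<..n+k}"] by (auto simp: block_def[abs_def])

text \<open>Appending one vector convolves the law of a block with \<open>\<mu>\<close>, wherever
  the block starts, so induction on the length removes the starting point.\<close>

lemma distr_block: "distr P F (block a (a + k)) = distr P F (block 0 k)"
proof (induction k)
  case 0
  then show ?case by (simp add: block_def[abs_def])
next
  case (Suc k)
  have "distr P F (block a (a + Suc k))
      = distr (distr P F (block a (a + k)) \<Otimes>\<^sub>M \<mu>) F (\<lambda>(x, y). x + y)" for a
  proof -
    have "indep_var F (block a (a + k)) F (X (Suc (a + k)))"
      using indep_sums[of "{a<..a+k}" "{Suc (a+k)}"] by (auto simp: block_def[abs_def])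
    then have "distr P F (block a (a + k)) \<Otimes>\<^sub>M \<mu>
        = distr P (F \<Otimes>\<^sub>M F) (\<lambda>\<omega>. (block a (a + k) \<omega>, X (Suc (a + k)) \<omega>))"
      unfolding indep_var_distribution_eq using law[of "Suc (a + k)"] by simp
    moreover have "(\<lambda>\<omega>. (block a (a + k) \<omega>, X (Suc (a + k)) \<omega>)) \<in> measurable P (F \<Otimes>\<^sub>M F)"
      by (intro measurable_Pair measurable_X) auto
    moreover have "block a (a + Suc k)
        = (\<lambda>(x, y). x + y) \<circ> (\<lambda>\<omega>. (block a (a + k) \<omega>, X (Suc (a + k)) \<omega>))"
      by (simp add: fun_eq_iff block_Suc del: add_Suc_right)
    ultimately show ?thesis using distr_distr[OF measurable_add] by metis
  qed
  from this[of a] this[of 0] Suc show ?case by simp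
qed

lemma nn_integral_blocks:
  fixes g h :: "'a \<Rightarrow> ennreal"
  assumes g: "g \<in> borel_measurable F" and h: "h \<in> borel_measurable F"
  shows "(\<integral>\<^sup>+\<omega>. g (block 0 n \<omega>) * h (block n (n + k) \<omega>) \<partial>P)
    = (\<integral>\<^sup>+\<omega>. g (block 0 n \<omega>) \<partial>P) * (\<integral>\<^sup>+\<omega>. h (block 0 k \<omega>) \<partial>P)"
proof -
  let ?Z = "case_bool (\<lambda>\<omega>. g (block 0 n \<omega>)) (\<lambda>\<omega>. h (block n (n + k) \<omega>))"
  have "indep_vars (case_bool borel borel) ?Z UNIV"
    using indep_var_compose[OF indep_blocks g h, of n k] unfolding indep_var_def comp_def .
  moreover have "case_bool borel borel = (\<lambda>_. borel :: ennreal measure)"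
    by (auto split: bool.split)
  ultimately have "(\<integral>\<^sup>+\<omega>. (\<Prod>i\<in>UNIV. ?Z i \<omega>) \<partial>P) = (\<Prod>i\<in>UNIV. \<integral>\<^sup>+\<omega>. ?Z i \<omega> \<partial>P)"
    by (intro indep_vars_nn_integral) auto
  then have "(\<integral>\<^sup>+\<omega>. g (block 0 n \<omega>) * h (block n (n + k) \<omega>) \<partial>P)
    = (\<integral>\<^sup>+\<omega>. g (block 0 n \<omega>) \<partial>P) * (\<integral>\<^sup>+\<omega>. h (block n (n + k) \<omega>) \<partial>P)"
    by (simp add: UNIV_bool mult.commute)
  moreover have "(\<integral>\<^sup>+\<omega>. h (block n (n + k) \<omega>) \<partial>P) = (\<integral>\<^sup>+\<omega>. h (block 0 k \<omega>) \<partial>P)"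
    using nn_integral_distr[of "block n (n + k)" P F h] nn_integral_distr[of "block 0 k" P F h]
      distr_block[of n k] h by simp
  ultimately show ?thesis by simp
qed

lemma block_mean_in:
  assumes "1 \<le> k" "\<omega> \<in> space P"
  shows "(1 / real k) *\<^sub>R block n (n + k) \<omega> \<in> D"
proof -
  have "(\<Sum>i\<in>{n<..n+k}. (1 / real k) *\<^sub>R X i \<omega>) \<in> D"
    using assms by (intro convex_sum convex_D X_in) auto
  then show ?thesis by (simp add: block_def scaleR_sum_right)
qed

text \<open>Serves two families \<open>g\<close>: indicators of dilated balls, and exponentials of
  \<open>n f\<close> cut off by a convex set. The hypothesis \<open>super\<close> is restricted to
  arguments whose means lie in \<open>D\<close>, because concavity holds only there and a possibly
  nonmeasurable \<open>D\<close> cannot be built into \<open>g\<close>; the blocks satisfy the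
  restriction by convexity of \<open>D\<close>.\<close>

lemma nn_integral_superadditive:
  fixes g :: "nat \<Rightarrow> 'a \<Rightarrow> ennreal"
  assumes g: "\<And>n. 1 \<le> n \<Longrightarrow> g n \<in> borel_measurable F"
    and super: "\<And>n k x y. 1 \<le> n \<Longrightarrow> 1 \<le> k \<Longrightarrow> (1 / real n) *\<^sub>R x \<in> D \<Longrightarrow> (1 / real k) *\<^sub>R y \<in> D
      \<Longrightarrow> g n x * g k y \<le> g (n + k) (x + y)"
    and "1 \<le> n" "1 \<le> q"
  shows "(\<integral>\<^sup>+\<omega>. g n (block 0 n \<omega>) \<partial>P) ^ q \<le> (\<integral>\<^sup>+\<omega>. g (q * n) (block 0 (q * n) \<omega>) \<partial>P)"
  using \<open>1 \<le> q\<close>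
proof (induction q rule: dec_induct)
  case base
  then show ?case by simp
next
  case (step q)
  let ?Q = "\<lambda>n. \<integral>\<^sup>+\<omega>. g n (block 0 n \<omega>) \<partial>P"
  have qn: "1 \<le> q * n" using step.hyps \<open>1 \<le> n\<close> by (simp add: Suc_le_eq)
  have "?Q n ^ Suc q = ?Q n ^ q * ?Q n" by (simp add: mult.commute)
  also have "\<dots> \<le> ?Q (q * n) * ?Q n" using step.IH by (intro mult_right_mono) auto
  also have "\<dots> = (\<integral>\<^sup>+\<omega>. g (q * n) (block 0 (q * n) \<omega>) * g n (block (q * n) (q * n + n) \<omega>) \<partial>P)"
    by (rule nn_integral_blocks[symmetric, OF g[OF qn] g[OF \<open>1 \<le> n\<close>]])
  also have "\<dots> \<le> (\<integral>\<^sup>+\<omega>. g (q * n + n) (block 0 (q * n + n) \<omega>) \<partial>P)"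
  proof (rule nn_integral_mono)
    fix \<omega> assume \<omega>: "\<omega> \<in> space P"
    show "g (q * n) (block 0 (q * n) \<omega>) * g n (block (q * n) (q * n + n) \<omega>)
        \<le> g (q * n + n) (block 0 (q * n + n) \<omega>)"
      unfolding block_add using qn \<omega> \<open>1 \<le> n\<close> block_mean_in[of "q * n" \<omega> 0] block_mean_in[of n \<omega> "q * n"]
      by (intro super) auto
  qed
  also have "q * n + n = Suc q * n" by simp
  finally show ?case .
qed

lemma sample_mean_block: "sample_mean X n \<omega> = (1 / real n) *\<^sub>R block 0 n \<omega>"
proof -
  have "{1..n} = {0<..n}" by auto
  then show ?thesis by (simp add: sample_mean_def block_def)
qed

lemma measurable_sample_mean [measurable]: "sample_mean X n \<in> measurable P F"
  using measurable_compose[OF measurable_block measurable_affine[of "1 / real n" 0]]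
  by (simp add: sample_mean_block[abs_def])

lemma sample_mean_in: "1 \<le> n \<Longrightarrow> \<omega> \<in> space P \<Longrightarrow> sample_mean X n \<omega> \<in> D"
  using block_mean_in[of n \<omega> 0] by (simp add: sample_mean_block)

lemma emeasure_cramer:
  "A \<in> sets F \<Longrightarrow>
    emeasure (cramer_sequence C0 P X n) A = emeasure P {\<omega> \<in> space P. sample_mean X n \<omega> \<in> A}"
  unfolding cramer_sequence_def
  by (subst emeasure_distr) (auto intro!: arg_cong[where f="emeasure P"])

section \<open>Entropy and finite sample sizes\<close>

lemma sets_dilated:
  assumes "C \<in> C0" "a > 0"
  shows "{\<omega> \<in> space P. block m n \<omega> - x \<in> (*\<^sub>R) a ` C} \<in> events"
  using measurable_sets[OF measurable_block sets_ball[OF assms(1), of a x]] assms(2)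
  by (auto simp: vimage_def Int_def conj_commute)

text \<open>The centres \<open>n x\<close> and the radii \<open>n r\<close> are both additive in
  \<open>n\<close>, so the indicators of these balls satisfy the superadditivity hypothesis.\<close>

lemma prob_dilated_power:
  assumes C: "C \<in> C0" and r: "0 < r" and n: "1 \<le> n" and q: "1 \<le> q"
  shows "prob {\<omega> \<in> space P. block 0 n \<omega> - real n *\<^sub>R x \<in> (*\<^sub>R) (real n * r) ` C} ^ q
    \<le> prob {\<omega> \<in> space P. block 0 (q * n) \<omega> - real (q * n) *\<^sub>R x \<in> (*\<^sub>R) (real (q * n) * r) ` C}"
proof -
  define B where "B n = {y. y - real n *\<^sub>R x \<in> (*\<^sub>R) (real n * r) ` C}" for n :: nat
  have B: "B n \<in> sets F" if "1 \<le> n" for n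
    unfolding B_def using r that by (intro sets_ball[OF C]) auto
  have ev: "(\<integral>\<^sup>+\<omega>. indicator (B n) (block 0 n \<omega>) \<partial>P)
      = ennreal (prob {\<omega> \<in> space P. block 0 n \<omega> - real n *\<^sub>R x \<in> (*\<^sub>R) (real n * r) ` C})"
    if "1 \<le> n" for n
  proof -
    have "(\<integral>\<^sup>+\<omega>. indicator (B n) (block 0 n \<omega>) \<partial>P)
        = (\<integral>\<^sup>+\<omega>. indicator {\<omega> \<in> space P. block 0 n \<omega> \<in> B n} \<omega> \<partial>P)"
      by (intro nn_integral_cong) (auto simp: indicator_def)
    also have "\<dots> = emeasure P {\<omega> \<in> space P. block 0 n \<omega> \<in> B n}"
      using measurable_sets[OF measurable_block B[OF that]]
      by (intro nn_integral_indicator) (simp add: vimage_def Int_def conj_commute)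
    finally show ?thesis by (simp add: B_def emeasure_eq_measure)
  qed
  have "(\<integral>\<^sup>+\<omega>. indicator (B n) (block 0 n \<omega>) \<partial>P) ^ q
      \<le> (\<integral>\<^sup>+\<omega>. indicator (B (q * n)) (block 0 (q * n) \<omega>) \<partial>P)"
  proof (rule nn_integral_superadditive[OF _ _ n q])
    fix n k :: nat and y z :: 'a
    assume nk: "1 \<le> n" "1 \<le> k"
    have "y + z \<in> B (n + k)" if "y \<in> B n" "z \<in> B k"
    proof -
      have "(y - real n *\<^sub>R x) + (z - real k *\<^sub>R x) \<in> (*\<^sub>R) (real n * r + real k * r) ` C"
        using that r by (intro C0_dilate_add[OF C]) (auto simp: B_def)
      moreover have "(y - real n *\<^sub>R x) + (z - real k *\<^sub>R x) = y + z - real (n + k) *\<^sub>R x"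
        by (simp add: scaleR_add_left)
      moreover have "real n * r + real k * r = real (n + k) * r" by (simp add: distrib_right)
      ultimately show ?thesis unfolding B_def by simp
    qed
    then show "indicator (B n) y * indicator (B k) z \<le> (indicator (B (n + k)) (y + z) :: ennreal)"
      by (auto simp: indicator_def)
  qed (use B in auto)
  moreover have "1 \<le> q * n" using n q by (simp add: Suc_le_eq)
  ultimately show ?thesis using ev[OF n] ev[of "q * n"] by (simp add: ennreal_power)
qed

text \<open>Version for two blocks with unrelated centres and radii, meant for attaching a short
  remainder block to a long run of equal blocks.\<close>

lemma prob_dilated_add:
  assumes C: "C \<in> C0" and ab: "0 < a" "0 < b" "a + b \<le> c"
  shows "prob {\<omega> \<in> space P. block 0 n \<omega> - x \<in> (*\<^sub>R) a ` C}
      * prob {\<omega> \<in> space P. block 0 k \<omega> - y \<in> (*\<^sub>R) b ` C}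
    \<le> prob {\<omega> \<in> space P. block 0 (n + k) \<omega> - (x + y) \<in> (*\<^sub>R) c ` C}"
proof -
  let ?A = "{z. z - x \<in> (*\<^sub>R) a ` C}" and ?B = "{z. z - y \<in> (*\<^sub>R) b ` C}"
  have AB: "?A \<in> sets F" "?B \<in> sets F" using sets_ball[OF C] ab by auto
  have "prob {\<omega> \<in> space P. block 0 k \<omega> - y \<in> (*\<^sub>R) b ` C}
      = prob {\<omega> \<in> space P. block n (n + k) \<omega> - y \<in> (*\<^sub>R) b ` C}"
    using measure_distr[OF measurable_block AB(2), of 0 k]
      measure_distr[OF measurable_block AB(2), of n "n+k"] distr_block[of n k]
    by (simp add: vimage_def Int_def conj_commute)
  then have "prob {\<omega> \<in> space P. block 0 n \<omega> - x \<in> (*\<^sub>R) a ` C}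
      * prob {\<omega> \<in> space P. block 0 k \<omega> - y \<in> (*\<^sub>R) b ` C}
    = prob ((\<lambda>\<omega>. (block 0 n \<omega>, block n (n + k) \<omega>)) -` (?A \<times> ?B) \<inter> space P)"
    using indep_varD[OF indep_blocks AB, of n k] by (simp add: vimage_def Int_def conj_commute)
  also have "\<dots> \<le> prob {\<omega> \<in> space P. block 0 (n + k) \<omega> - (x + y) \<in> (*\<^sub>R) c ` C}"
  proof (intro finite_measure_mono sets_dilated[OF C] subsetI)
    fix \<omega> assume "\<omega> \<in> (\<lambda>\<omega>. (block 0 n \<omega>, block n (n + k) \<omega>)) -` (?A \<times> ?B) \<inter> space P"
    then have \<omega>: "\<omega> \<in> space P" "block 0 n \<omega> - x \<in> (*\<^sub>R) a ` C"
      "block n (n + k) \<omega> - y \<in> (*\<^sub>R) b ` C" by auto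
    have "(block 0 n \<omega> - x) + (block n (n + k) \<omega> - y) \<in> (*\<^sub>R) (a + b) ` C"
      using ab by (intro C0_dilate_add[OF C _ _ \<omega>(2,3)]) auto
    moreover have "(block 0 n \<omega> - x) + (block n (n + k) \<omega> - y) = block 0 (n + k) \<omega> - (x + y)"
      by (simp add: block_add)
    ultimately have "block 0 (n + k) \<omega> - (x + y) \<in> (*\<^sub>R) (a + b) ` C" by simp
    then have "block 0 (n + k) \<omega> - (x + y) \<in> (*\<^sub>R) c ` C"
      using ab by (elim C0_dilate_mono[OF C C, rotated -1]) auto
    then show "\<omega> \<in> {\<omega> \<in> space P. block 0 (n + k) \<omega> - (x + y) \<in> (*\<^sub>R) c ` C}" using \<omega>(1) by simp
  qed (use ab in auto)
  finally show ?thesis .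
qed

text \<open>The factor \<open>1\<close> in the radius is kept so that the right-hand side is the
  case \<open>r = 1\<close> of the events in \<open>prob_dilated_power\<close>.\<close>

lemma emeasure_cramer_translate:
  assumes C: "C \<in> C0" and n: "1 \<le> n"
  shows "emeasure (cramer_sequence C0 P X n) ((+) x ` C)
    = ennreal (prob {\<omega> \<in> space P. block 0 n \<omega> - real n *\<^sub>R x \<in> (*\<^sub>R) (real n * 1) ` C})"
proof -
  have mem: "v \<in> C \<longleftrightarrow> real n *\<^sub>R v \<in> (*\<^sub>R) (real n) ` C" for v using n by auto
  have "real n *\<^sub>R (sample_mean X n \<omega> - x) = block 0 n \<omega> - real n *\<^sub>R x" for \<omega>
    using n by (simp add: sample_mean_block scaleR_diff_right)
  then have "sample_mean X n \<omega> \<in> (+) x ` C \<longleftrightarrow> block 0 n \<omega> - real n *\<^sub>R x \<in> (*\<^sub>R) (real n * 1) ` C" for \<omega>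
    using mem[of "sample_mean X n \<omega> - x"] by (simp add: translate_mem_iff)
  then show ?thesis
    using emeasure_cramer[OF sets_translate[OF C]] by (simp add: emeasure_eq_measure)
qed

text \<open>By the strict gauge inequality the ball is the increasing union of its smaller
  concentric dilates, so continuity from below keeps the probability above \<open>c\<close> for some
  \<open>r < 1\<close>.\<close>

lemma prob_dilated_limit:
  assumes C: "C \<in> C0" and a: "0 < a"
    and less: "c < prob {\<omega> \<in> space P. block 0 n \<omega> - x \<in> (*\<^sub>R) a ` C}"
  shows "\<exists>r. 0 < r \<and> r < 1 \<and> c < prob {\<omega> \<in> space P. block 0 n \<omega> - x \<in> (*\<^sub>R) (a * r) ` C}"
proof -
  define r where "r j = 1 - 1 / (real j + 2)" for j :: nat
  have r: "0 < r j" "r j < 1" for j by (simp_all add: r_def)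
  have r_mono: "r i \<le> r j" if "i \<le> j" for i j
    using that unfolding r_def by (intro diff_left_mono divide_left_mono) auto
  define A where "A j = {\<omega> \<in> space P. block 0 n \<omega> - x \<in> (*\<^sub>R) (a * r j) ` C}" for j
  have "A j \<in> events" for j unfolding A_def using a r[of j] by (intro sets_dilated[OF C]) simp
  moreover have "incseq A"
  proof (rule incseq_SucI, rule subsetI)
    fix j \<omega> assume "\<omega> \<in> A j"
    moreover have "a * r j \<le> a * r (Suc j)" using a r_mono[of j "Suc j"] by simp
    ultimately show "\<omega> \<in> A (Suc j)"
      using C0_dilate_mono[OF C C, of "a * r j" "a * r (Suc j)"] a r[of j] by (simp add: A_def)
  qed
  ultimately have lim: "(\<lambda>j. prob (A j)) \<longlonglongrightarrow> prob (\<Union>j. A j)"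
    by (intro finite_Lim_measure_incseq) auto
  have "{\<omega> \<in> space P. block 0 n \<omega> - x \<in> (*\<^sub>R) a ` C} \<subseteq> (\<Union>j. A j)"
  proof
    fix \<omega> assume "\<omega> \<in> {\<omega> \<in> space P. block 0 n \<omega> - x \<in> (*\<^sub>R) a ` C}"
    then have \<omega>: "\<omega> \<in> space P" "block 0 n \<omega> - x \<in> (*\<^sub>R) a ` C" by auto
    obtain b where b: "0 < b" "b < a" "block 0 n \<omega> - x \<in> (*\<^sub>R) b ` C"
      using C0_shrink[OF C a \<omega>(2)] by blast
    obtain j :: nat where "1 / (real j + 2) < 1 - b / a" using archimedean_step[of "1 - b/a"] b a by auto
    then have "b / a \<le> r j" by (simp add: r_def)
    then have "b \<le> a * r j" using a by (simp add: field_simps)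
    then have "\<omega> \<in> A j"
      using C0_dilate_mono[OF C C _ _ b(3), of "a * r j"] b(1) \<omega>(1) by (simp add: A_def)
    then show "\<omega> \<in> (\<Union>j. A j)" by blast
  qed
  then have "prob {\<omega> \<in> space P. block 0 n \<omega> - x \<in> (*\<^sub>R) a ` C} \<le> prob (\<Union>j. A j)"
    using \<open>\<And>j. A j \<in> events\<close> by (intro finite_measure_mono) auto
  with less have "c < prob (\<Union>j. A j)" by simp
  from order_tendstoD(1)[OF lim this] obtain j where "c < prob (A j)"
    by (auto simp: eventually_sequentially)
  then show ?thesis using r[of j] unfolding A_def by blast
qed

text \<open>Controls the remainder blocks: since \<open>C\<close> is absorbing, the events that all
  the finitely many sums lie within radius \<open>j + 1\<close> increase to the whole space. The
  room \<open>t\<close> and the factor \<open>c\<close> then depend on \<open>N\<close> only, not on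
  the total number of vectors.\<close>

lemma prob_dilated_uniform:
  assumes C: "C \<in> C0"
  shows "\<exists>t c. 0 < t \<and> 0 < c \<and>
    (\<forall>i<N. c \<le> prob {\<omega> \<in> space P. block 0 i \<omega> - real i *\<^sub>R x \<in> (*\<^sub>R) t ` C})"
proof -
  define H where "H i j \<omega> \<longleftrightarrow> block 0 i \<omega> - real i *\<^sub>R x \<in> (*\<^sub>R) (real j + 1) ` C" for i j :: nat and \<omega>
  define A where "A j = {\<omega> \<in> space P. \<forall>i\<in>{..<N}. H i j \<omega>}" for j
  have H: "{\<omega> \<in> space P. H i j \<omega>} \<in> events" for i j
    unfolding H_def by (intro sets_dilated[OF C]) simp
  have mem: "A j \<in> events" for j
    unfolding A_def by (intro sets.sets_Collect_finite_All H) auto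
  moreover have "incseq A"
  proof (rule incseq_SucI, rule subsetI)
    fix j \<omega> assume \<omega>: "\<omega> \<in> A j"
    have "H i (Suc j) \<omega>" if "H i j \<omega>" for i
      using that unfolding H_def by (elim C0_dilate_mono[OF C C, rotated -1]) auto
    then show "\<omega> \<in> A (Suc j)" using \<omega> unfolding A_def by blast
  qed
  ultimately have lim: "(\<lambda>j. prob (A j)) \<longlonglongrightarrow> prob (\<Union>j. A j)"
    by (intro finite_Lim_measure_incseq) auto
  have "\<exists>j. \<omega> \<in> A j" if \<omega>: "\<omega> \<in> space P" for \<omega>
  proof -
    have "\<exists>s>0. block 0 i \<omega> - real i *\<^sub>R x \<in> (*\<^sub>R) s ` C" for i by (rule C0_absorbing[OF C])
    then obtain s where s: "\<And>i. 0 < s i" "\<And>i. block 0 i \<omega> - real i *\<^sub>R x \<in> (*\<^sub>R) (s i) ` C"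
      by metis
    obtain j :: nat where j: "(\<Sum>i<N. s i) \<le> real j" using real_arch_simple by blast
    have "H i j \<omega>" if "i < N" for i
    proof -
      have "s i \<le> (\<Sum>i<N. s i)" using that s(1) by (intro member_le_sum) (auto intro: less_imp_le)
      then show ?thesis
        unfolding H_def using j s(1)[of i] by (intro C0_dilate_mono[OF C C _ _ s(2)[of i]]) auto
    qed
    then show ?thesis using \<omega> unfolding A_def by blast
  qed
  moreover have "A j \<subseteq> space P" for j by (auto simp: A_def)
  ultimately have "(\<Union>j. A j) = space P" by blast
  with lim have "(\<lambda>j. prob (A j)) \<longlonglongrightarrow> 1" by (simp add: prob_space)
  from order_tendstoD(1)[OF this, of 0] obtain j where j: "0 < prob (A j)"
    by (auto simp: eventually_sequentially)
  have "prob (A j) \<le> prob {\<omega> \<in> space P. H i j \<omega>}" if "i < N" for i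
    using that H by (intro finite_measure_mono) (auto simp: A_def)
  with j show ?thesis
    unfolding H_def by (intro exI[of _ "real j + 1"] exI[of _ "prob (A j)"]) simp
qed

text \<open>Blocks of length \<open>N\<close> landing in a slightly smaller copy of \<open>C\<close> leave room for the remainder
  of \<open>n\<close> modulo \<open>N\<close>; hence \<open>liminf\<close> dominates every single term.\<close>

lemma emeasure_cramer_le_exp:
  assumes C: "C \<in> C0" and N: "1 \<le> N"
    and lim: "liminf (\<lambda>n. ereal (1 / real n) *
      log_ennreal (emeasure (cramer_sequence C0 P X n) ((+) x ` C))) < ereal b"
  shows "emeasure (cramer_sequence C0 P X N) ((+) x ` C) \<le> ennreal (exp (real N * b))"
proof (rule ccontr)
  define p where "p n r = prob {\<omega> \<in> space P. block 0 n \<omega> - real n *\<^sub>R x \<in> (*\<^sub>R) (real n * r) ` C}" for n r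
  have em: "emeasure (cramer_sequence C0 P X n) ((+) x ` C) = ennreal (p n 1)" if "1 \<le> n" for n
    unfolding p_def using emeasure_cramer_translate[OF C that] .
  assume "\<not> ?thesis"
  then have "exp (real N * b) < p N 1" by (simp add: em[OF N] not_le ennreal_less_iff)
  \<comment> \<open>The strict inequality at radius \<open>1\<close>, obtained from the negated
    claim, survives a small contraction.\<close>
  then obtain r where r: "0 < r" "r < 1" "exp (real N * b) < p N r"
    unfolding p_def using prob_dilated_limit[OF C, of "real N" "exp (real N * b)" N "real N *\<^sub>R x"] N by auto
  obtain t c where tc: "0 < t" "0 < c"
    "\<And>i. i < N \<Longrightarrow> c \<le> prob {\<omega> \<in> space P. block 0 i \<omega> - real i *\<^sub>R x \<in> (*\<^sub>R) t ` C}"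
    using prob_dilated_uniform[OF C, of N x] by blast
  have \<rho>: "0 < p N r" using r(3) exp_gt_zero by (rule order.strict_trans[rotated])
  have ln\<rho>: "real N * b < ln (p N r)" using r(3) \<rho> by (metis exp_less_cancel_iff exp_ln)
  \<comment> \<open>The gain over the rate \<open>b\<close> achieved by each full block of length
    \<open>N\<close>.\<close>
  define \<delta> where "\<delta> = ln (p N r) - real N * b"
  have \<delta>: "0 < \<delta>" using ln\<rho> by (simp add: \<delta>_def)
  \<comment> \<open>\<open>Q\<close> blocks must leave the room \<open>t\<close> for the remainder
    and gain enough to pay for the factor \<open>c\<close> and for the at most \<open>N\<close>
    leftover vectors; the summand \<open>1\<close> gives \<open>1 \<le> Q\<close>.\<close>
  obtain Q :: nat where Q: "max (t / (1 - r)) ((real N * \<bar>b\<bar> - ln c) / \<delta>) + 1 \<le> real Q"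
    using real_arch_simple by blast
  have Qr: "t \<le> real Q * (1 - r)" "real N * \<bar>b\<bar> - ln c \<le> real Q * \<delta>" "1 \<le> Q"
  proof -
    have "t / (1 - r) \<le> real Q" "(real N * \<bar>b\<bar> - ln c) / \<delta> \<le> real Q" using Q by linarith+
    then show "t \<le> real Q * (1 - r)" "real N * \<bar>b\<bar> - ln c \<le> real Q * \<delta>"
      using r(2) \<delta> by (simp_all add: pos_divide_le_eq)
    have "0 \<le> t / (1 - r)" using tc(1) r(2) by simp
    then have "1 \<le> real Q" using Q by linarith
    then show "1 \<le> Q" by simp
  qed
  \<comment> \<open>Once this holds for all large \<open>n\<close>, the \<open>liminf\<close> is at
    least \<open>b\<close>, against the assumption.\<close>
  have "ereal b \<le> ereal (1 / real n) * log_ennreal (emeasure (cramer_sequence C0 P X n) ((+) x ` C))"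
    if n: "Q * N \<le> n" for n
  proof -
    define q i where "q = n div N" and "i = n mod N"
    have n_eq: "n = q * N + i" and i: "i < N" using N by (simp_all add: q_def i_def)
    have q: "Q \<le> q" unfolding q_def using n N by (simp add: less_eq_div_iff_mult_less_eq)
    have n1: "1 \<le> n" using n N Qr(3) by (metis One_nat_def Suc_leI le_trans mult_le_mono nat_mult_1)
    have qN: "real Q \<le> real (q * N)" using q N by (metis le_trans mult.right_neutral mult_le_mono2 of_nat_mono)
    have "t \<le> real (q * N) * (1 - r)"
      using Qr(1) mult_right_mono[OF qN, of "1 - r"] r(2) by linarith
    then have room: "real (q * N) * r + t \<le> real n * 1" using n_eq by (simp add: algebra_simps)
    have "p N r ^ q * c \<le> p (q * N) r * prob {\<omega> \<in> space P. block 0 i \<omega> - real i *\<^sub>R x \<in> (*\<^sub>R) t ` C}"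
      unfolding p_def using Qr(3) q tc
      by (intro mult_mono prob_dilated_power[OF C r(1) N] tc(3)[OF i]) auto
    also have "\<dots> \<le> prob {\<omega> \<in> space P. block 0 (q * N + i) \<omega> - (real (q * N) *\<^sub>R x + real i *\<^sub>R x)
        \<in> (*\<^sub>R) (real n * 1) ` C}"
      unfolding p_def using tc(1) r(1) qN Qr(3) by (intro prob_dilated_add[OF C _ _ room]) auto
    also have "\<dots> = p n 1" unfolding p_def n_eq by (simp add: scaleR_add_left)
    finally have pn: "p N r ^ q * c \<le> p n 1" .
    \<comment> \<open>The sign of \<open>b\<close> is unknown, so the contribution of the remainder
      is estimated by \<open>\<bar>b\<bar>\<close>.\<close>
    have "real i * b \<le> real i * \<bar>b\<bar>" by (intro mult_left_mono) auto
    moreover have "real i * \<bar>b\<bar> \<le> real N * \<bar>b\<bar>" using i by (intro mult_right_mono) auto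
    moreover have "real Q * \<delta> \<le> real q * \<delta>" using q \<delta> by simp
    ultimately have "real i * b - ln c \<le> real q * \<delta>" using Qr(2) by linarith
    then have "real n * b \<le> real q * ln (p N r) + ln c"
      unfolding \<delta>_def n_eq by (simp add: algebra_simps)
    also have "\<dots> = ln (p N r ^ q * c)" using \<rho> tc(2) by (simp add: ln_mult ln_realpow)
    also have "\<dots> \<le> ln (p n 1)" using pn \<rho> tc(2) by (intro ln_mono) auto
    finally have "b \<le> (1 / real n) * ln (p n 1)" using n1 by (simp add: field_simps)
    moreover have "0 < p n 1" using pn \<rho> tc(2) by (metis less_le_trans mult_pos_pos zero_less_power)
    ultimately show ?thesis using em[OF n1] by (simp add: log_ennreal_def)
  qed
  then have "ereal b \<le> liminf (\<lambda>n. ereal (1 / real n) *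
      log_ennreal (emeasure (cramer_sequence C0 P X n) ((+) x ` C)))"
    by (intro Liminf_bounded) (auto simp: eventually_sequentially)
  with lim show False by simp
qed

end

section \<open>Exponentials of extended reals\<close>

lemma exp_ereal_ereal [simp]: "exp_ereal (ereal r) = ennreal (exp r)"
  and exp_ereal_minf [simp]: "exp_ereal (-\<infinity>) = 0"
  and exp_ereal_pinf [simp]: "exp_ereal \<infinity> = \<infinity>"
  by (simp_all add: exp_ereal_def)

lemma exp_ereal_mono: "x \<le> y \<Longrightarrow> exp_ereal x \<le> exp_ereal y"
  by (cases x; cases y) (auto simp: ennreal_leI)

text \<open>Only an inequality: for the arguments \<open>-\<infinity>\<close> and
  \<open>\<infinity>\<close> the product is \<open>0\<close>, while the sum is
  \<open>\<infinity>\<close> by convention. Superadditivity needs just this direction.\<close>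

lemma exp_ereal_add: "exp_ereal x * exp_ereal y \<le> exp_ereal (x + y)"
  by (cases x; cases y) (auto simp: exp_add ennreal_mult)

lemma measurable_exp_ereal [measurable]: "exp_ereal \<in> borel_measurable borel"
  unfolding exp_ereal_def[abs_def] by measurable

lemma scaled_log_le:
  assumes "E \<le> ennreal (exp (real n * r))" "1 \<le> n"
  shows "ereal (1 / real n) * log_ennreal E \<le> ereal r"
proof (cases E)
  case (real e)
  show ?thesis
  proof (cases "e = 0")
    case True
    then show ?thesis using real assms(2) by (simp add: log_ennreal_def)
  next
    case False
    then have "0 < e" using real by simp
    moreover have "e \<le> exp (real n * r)" using assms(1) real by simp
    ultimately have "ln e \<le> real n * r" by (metis exp_le_cancel_iff exp_ln)
    then have "(1 / real n) * ln e \<le> r" using assms(2) by (simp add: field_simps)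
    then show ?thesis using \<open>0 < e\<close> real by (simp add: log_ennreal_def)
  qed
next
  case top
  then show ?thesis using assms by (simp add: top_unique)
qed

text \<open>Turns a bound on a sum into separate real bounds. If one summand is
  \<open>-\<infinity>\<close>, the other is below \<open>\<infinity>\<close>, since otherwise the
  sum would be \<open>\<infinity>\<close>; any real bound \<open>b\<close> for it is then
  compensated by \<open>m - b\<close>.\<close>

lemma ereal_split_less:
  fixes u v :: ereal
  assumes "u + v < ereal m"
  shows "\<exists>a b. u < ereal a \<and> v < ereal b \<and> a + b \<le> m"
proof -
  have split: "\<exists>a b. u < ereal a \<and> v < ereal b \<and> a + b \<le> m" if uv: "u = -\<infinity>" "v < \<infinity>" for u v :: ereal
  proof -
    obtain b where "v < ereal b" using uv(2) ereal_dense2 by blast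
    then show ?thesis using uv by (intro exI[of _ "m - b"] exI[of _ b]) auto
  qed
  show ?thesis
  proof (cases u)
    case (real x)
    show ?thesis
    proof (cases v)
      case (real y)
      define e where "e = (m - x - y) / 2"
      have "0 < e" using assms real \<open>u = ereal x\<close> by (simp add: e_def)
      moreover have "(x + e) + (y + e) = m" by (simp add: e_def)
      ultimately show ?thesis using real \<open>u = ereal x\<close>
        by (intro exI[of _ "x + e"] exI[of _ "y + e"]) auto
    next
      case MInf
      then obtain b a where "v < ereal b" "u < ereal a" "b + a \<le> m" using split[of v u] real by auto
      then show ?thesis by (intro exI[of _ a] exI[of _ b]) auto
    qed (use assms real in auto)
  next
    case MInf
    then show ?thesis using split[of u v] assms by (cases v) auto
  qed (use assms in auto)
qed

text \<open>The tensor power trick: if \<open>V > c\<close>, the powers of \<open>V / c\<close>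
  eventually exceed the constant \<open>k\<close>.\<close>

lemma ennreal_le_of_powers:
  fixes V :: ennreal
  assumes "0 < c" and V: "\<And>q. 1 \<le> q \<Longrightarrow> V ^ q \<le> ennreal (k * c ^ q)"
  shows "V \<le> ennreal c"
proof (cases V)
  case (real v)
  show ?thesis
  proof (rule ccontr)
    assume "\<not> ?thesis"
    then have "c < v" using real \<open>0 < c\<close> by (simp add: not_le ennreal_less_iff)
    then have "1 < v / c" using \<open>0 < c\<close> by simp
    then obtain q where q: "max k 1 < (v / c) ^ q" using real_arch_pow by blast
    then have "q \<noteq> 0" by (intro notI) auto
    then have "ennreal (v ^ q) \<le> ennreal (k * c ^ q)" using V[of q] real by (simp add: ennreal_power)
    moreover have "k * c ^ q < v ^ q"
      using q \<open>0 < c\<close> by (simp add: power_divide field_simps)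
    moreover have "0 < v ^ q" using \<open>0 < c\<close> \<open>c < v\<close> by simp
    ultimately show False by (metis ennreal_less_iff ennreal_neg le_less_linear less_imp_le not_less ennreal_lessI)
  qed
next
  case top
  then show ?thesis using V[of 1] by (simp add: top_unique)
qed

lemma (in prob_space) nn_integral_le_of_large_events:
  fixes h :: "'a \<Rightarrow> ennreal"
  assumes h: "h \<in> borel_measurable M" and A: "\<And>m. A m \<in> events"
    and lim: "(\<lambda>m. prob (A m)) \<longlonglongrightarrow> 1"
    and le: "\<And>m. (\<integral>\<^sup>+x. h x * indicator (A m) x \<partial>M) \<le> c"
  shows "(\<integral>\<^sup>+x. h x \<partial>M) \<le> c"
proof -
  have trunc: "(\<integral>\<^sup>+x. min (h x) (of_nat R) \<partial>M) \<le> c" for R :: nat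
  proof -
    have "(\<integral>\<^sup>+x. min (h x) (of_nat R) \<partial>M) \<le> c + ennreal (real R * (1 - prob (A m)))" for m
    proof -
      have "(\<integral>\<^sup>+x. min (h x) (of_nat R) \<partial>M)
          \<le> (\<integral>\<^sup>+x. h x * indicator (A m) x + of_nat R * indicator (space M - A m) x \<partial>M)"
        by (intro nn_integral_mono) (auto simp: indicator_def)
      also have "\<dots> = (\<integral>\<^sup>+x. h x * indicator (A m) x \<partial>M) + of_nat R * emeasure M (space M - A m)"
        using h A by (subst nn_integral_add) (auto simp: nn_integral_cmult_indicator)
      also have "of_nat R * emeasure M (space M - A m) = ennreal (real R * (1 - prob (A m)))"
        using A prob_compl[OF A] by (simp add: emeasure_eq_measure ennreal_mult ennreal_of_nat_eq_real_of_nat)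
      finally show ?thesis using le[of m] by (meson add_right_mono order_trans)
    qed
    moreover have "(\<lambda>m. c + ennreal (real R * (1 - prob (A m)))) \<longlonglongrightarrow> c + ennreal (real R * (1 - 1))"
      using lim by (intro tendsto_intros)
    ultimately show ?thesis by (intro LIMSEQ_le_const[of _ c]) auto
  qed
  have "h x = (SUP R. min (h x) (of_nat R))" for x
  proof -
    have "(SUP R. min (h x) (of_nat R)) = min (h x) (SUP R. of_nat R)"
      by (simp add: inf_min[symmetric] inf_SUP)
    then show ?thesis by (simp add: ennreal_SUP_of_nat_eq_top)
  qed
  then have "(\<integral>\<^sup>+x. h x \<partial>M) = (\<integral>\<^sup>+x. (SUP R. min (h x) (of_nat R)) \<partial>M)" by simp
  also have "\<dots> = (SUP R. \<integral>\<^sup>+x. min (h x) (of_nat R) \<partial>M)"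
    using h by (intro nn_integral_monotone_convergence_SUP)
      (auto simp: incseq_def le_fun_def intro: min.coboundedI2)
  also have "\<dots> \<le> c" using trunc by (intro SUP_least) simp
  finally show ?thesis .
qed

text \<open>When \<open>D\<close> is not measurable, extending \<open>f\<close> by a constant off
  \<open>D\<close> may fail. Instead each trace \<open>f > r\<close> on \<open>D\<close>, for
  rational \<open>r\<close>, is cut out by a measurable \<open>E r\<close>, and the supremum of the
  \<open>r\<close> with \<open>x \<in> E r\<close> recovers \<open>f\<close> on
  \<open>D\<close>.\<close>

lemma borel_measurable_ereal_extension:
  fixes f :: "'a \<Rightarrow> ereal"
  assumes f: "f \<in> borel_measurable (restrict_space M D)" and M: "space M = UNIV"
  shows "\<exists>g \<in> borel_measurable M. \<forall>x\<in>D. g x = f x"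
proof -
  have "\<exists>E\<in>sets M. {x\<in>D. ereal (real_of_rat r) < f x} = E \<inter> D" for r
  proof -
    have "{x \<in> space (restrict_space M D). ereal (real_of_rat r) < f x} \<in> sets (restrict_space M D)"
      using f by measurable
    then show ?thesis using M by (auto simp: sets_restrict_space space_restrict_space)
  qed
  then obtain E where E: "\<And>r. E r \<in> sets M" "\<And>r. {x\<in>D. ereal (real_of_rat r) < f x} = E r \<inter> D" by metis
  define g where "g x = (SUP r. if x \<in> E r then ereal (real_of_rat r) else -\<infinity>)" for x
  have "g \<in> borel_measurable M"
    unfolding g_def[abs_def] using E(1) by (intro borel_measurable_SUP measurable_If_set) auto
  moreover have "g x = f x" if "x \<in> D" for x
  proof (rule antisym)
    have "r \<in> UNIV \<Longrightarrow> (if x \<in> E r then ereal (real_of_rat r) else -\<infinity>) \<le> f x" for r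
      using E(2)[of r] that by (auto intro: less_imp_le)
    then show "g x \<le> f x" unfolding g_def by (rule SUP_least)
    show "f x \<le> g x"
    proof (rule ccontr)
      assume "\<not> f x \<le> g x"
      then have "g x < f x" by simp
      then obtain z where z: "g x < ereal z" "ereal z < f x" using ereal_dense2 by blast
      \<comment> \<open>\<open>f x\<close> may be infinite, so a second real is inserted before a
        rational is chosen between the two.\<close>
      then obtain z' where z': "ereal z < ereal z'" "ereal z' < f x" using ereal_dense2 by blast
      then obtain r where r: "z < real_of_rat r" "real_of_rat r < z'"
        using of_rat_dense by auto
      then have "ereal (real_of_rat r) < f x" using z'(2) by (meson ereal_less_eq(3) less_imp_le order.strict_trans1)
      then have "x \<in> E r" using E(2)[of r] that by auto
      then have "ereal (real_of_rat r) \<le> g x" unfolding g_def by (intro SUP_upper2[of r]) auto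
      moreover have "g x < ereal (real_of_rat r)" using z(1) r(1) by (meson ereal_less_eq(3) less_imp_le order.strict_trans2)
      ultimately show False by simp
    qed
  qed
  ultimately show ?thesis by blast
qed

text \<open>Superadditivity of the perspective \<open>n f(x / n)\<close>: concavity with weight
  \<open>n / (n + k)\<close>, multiplied by \<open>n + k\<close>. A positive real factor distributes
  over the extended addition even when both infinities occur.\<close>

lemma concave_ext_scaled:
  fixes f :: "'a::real_vector \<Rightarrow> ereal"
  assumes "concave_ext_on D f" and nk: "1 \<le> n" "1 \<le> k"
    and x: "(1 / real n) *\<^sub>R x \<in> D" and y: "(1 / real k) *\<^sub>R y \<in> D"
  shows "ereal (real n) * f ((1 / real n) *\<^sub>R x) + ereal (real k) * f ((1 / real k) *\<^sub>R y)
    \<le> ereal (real (n + k)) * f ((1 / real (n + k)) *\<^sub>R (x + y))"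
proof -
  define \<alpha> where "\<alpha> = real n / real (n + k)"
  have \<alpha>: "\<alpha> \<in> {0..1}" "1 - \<alpha> = real k / real (n + k)" using nk by (auto simp: \<alpha>_def field_simps)
  let ?u = "f ((1 / real n) *\<^sub>R x)" and ?v = "f ((1 / real k) *\<^sub>R y)"
  have comb: "\<alpha> *\<^sub>R ((1 / real n) *\<^sub>R x) + (1 - \<alpha>) *\<^sub>R ((1 / real k) *\<^sub>R y) = (1 / real (n + k)) *\<^sub>R (x + y)"
    unfolding \<alpha>(2) unfolding \<alpha>_def using nk by (simp add: scaleR_add_right)
  have "ereal \<alpha> * ?u + ereal (1 - \<alpha>) * ?v \<le> f ((1 / real (n + k)) *\<^sub>R (x + y))"
    using assms(1) x y \<alpha>(1) unfolding concave_ext_on_def comb[symmetric] by blast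
  then have "ereal (real (n + k)) * (ereal \<alpha> * ?u + ereal (1 - \<alpha>) * ?v)
      \<le> ereal (real (n + k)) * f ((1 / real (n + k)) *\<^sub>R (x + y))"
    by (intro ereal_mult_left_mono) auto
  moreover have "ereal (real (n + k)) * (ereal \<alpha> * ?u + ereal (1 - \<alpha>) * ?v)
      = ereal (real (n + k) * \<alpha>) * ?u + ereal (real (n + k) * (1 - \<alpha>)) * ?v"
  proof -
    have "ereal r * (a + b) = ereal r * a + ereal r * b" if "0 < r" for r and a b :: ereal
      using that by (cases a; cases b) (auto simp: distrib_left)
    from this[of "real (n + k)" "ereal \<alpha> * ?u" "ereal (1 - \<alpha>) * ?v"] show ?thesis
      using nk by (simp add: mult.assoc[symmetric])
  qed
  moreover have "real (n + k) * \<alpha> = real n" "real (n + k) * (1 - \<alpha>) = real k"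
    unfolding \<alpha>(2) unfolding \<alpha>_def using nk by auto
  ultimately show ?thesis by simp
qed

section \<open>The upper bound\<close>

context iid_lcs
begin

text \<open>The hypothesis \<open>loc\<close> isolates what the two final bounds share: around each
  point of \<open>L\<close>, a bound \<open>a\<close> for \<open>f\<close> and a rate
  \<open>b\<close> valid for all \<open>n\<close>. The function \<open>f\<close> has to be
  controlled only on \<open>W \<inter> D\<close>.\<close>

lemma cramer_bound_compact:
  assumes f: "f \<in> borel_measurable F" "concave_ext_on D f"
    and W: "W \<in> sets F" "convex (W \<inter> D)"
    and L: "compactin (mlcs_topology C0) L" "W \<inter> D \<subseteq> L"
    and loc: "\<And>x. x \<in> L \<Longrightarrow> \<exists>a b C. a + b \<le> r \<and> C \<in> C0 \<and> (\<forall>y\<in>W \<inter> D \<inter> (+) x ` C. f y \<le> ereal a) \<and>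
      (\<forall>n\<ge>1. emeasure (cramer_sequence C0 P X n) ((+) x ` C) \<le> ennreal (exp (real n * b)))"
    and n: "1 \<le> n"
  shows "(\<integral>\<^sup>+\<omega>. exp_ereal (ereal (real n) * f (sample_mean X n \<omega>)) * indicator W (sample_mean X n \<omega>) \<partial>P)
    \<le> ennreal (exp (real n * r))"
proof -
  define g where "g n y = exp_ereal (ereal (real n) * f ((1 / real n) *\<^sub>R y)) * indicator W ((1 / real n) *\<^sub>R y)"
    for n :: nat and y
  have g_mean: "g n (block 0 n \<omega>)
      = exp_ereal (ereal (real n) * f (sample_mean X n \<omega>)) * indicator W (sample_mean X n \<omega>)" for n \<omega>
    by (simp add: g_def sample_mean_block)
  have g_meas: "g n \<in> borel_measurable F" for n
  proof -
    have "(\<lambda>y. (1 / real n) *\<^sub>R y) \<in> measurable F F" using measurable_affine[of "1 / real n" 0] by simp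
    note [measurable] = this f(1) W(1)
    show ?thesis unfolding g_def[abs_def] by measurable
  qed
  have super: "(\<integral>\<^sup>+\<omega>. g n (block 0 n \<omega>) \<partial>P) ^ q \<le> (\<integral>\<^sup>+\<omega>. g (q * n) (block 0 (q * n) \<omega>) \<partial>P)"
    if "1 \<le> q" for q
  proof (rule nn_integral_superadditive[OF g_meas _ n that])
    fix n k :: nat and x y :: 'a
    assume nk: "1 \<le> n" "1 \<le> k" and xy: "(1 / real n) *\<^sub>R x \<in> D" "(1 / real k) *\<^sub>R y \<in> D"
    show "g n x * g k y \<le> g (n + k) (x + y)"
    proof (cases "(1 / real n) *\<^sub>R x \<in> W \<and> (1 / real k) *\<^sub>R y \<in> W")
      case False
      then show ?thesis by (auto simp: g_def)
    next
      case True
      have "(real n / real (n + k)) *\<^sub>R ((1 / real n) *\<^sub>R x) + (real k / real (n + k)) *\<^sub>R ((1 / real k) *\<^sub>R y) \<in> W \<inter> D"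
        using True xy nk by (intro convexD[OF W(2)]) (auto simp: add_divide_distrib[symmetric])
      moreover have "(real n / real (n + k)) *\<^sub>R ((1 / real n) *\<^sub>R x) + (real k / real (n + k)) *\<^sub>R ((1 / real k) *\<^sub>R y)
          = (1 / real (n + k)) *\<^sub>R (x + y)"
        using nk by (simp add: scaleR_add_right)
      ultimately have "(1 / real (n + k)) *\<^sub>R (x + y) \<in> W" by simp
      then show ?thesis
        using True order_trans[OF exp_ereal_add exp_ereal_mono[OF concave_ext_scaled[OF f(2) nk xy]]]
        by (simp add: g_def)
    qed
  qed
  obtain a b C where abC: "\<And>x. x \<in> L \<Longrightarrow> a x + b x \<le> r" "\<And>x. x \<in> L \<Longrightarrow> C x \<in> C0"
    "\<And>x y. x \<in> L \<Longrightarrow> y \<in> W \<inter> D \<inter> (+) x ` C x \<Longrightarrow> f y \<le> ereal (a x)"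
    "\<And>x n. x \<in> L \<Longrightarrow> 1 \<le> n \<Longrightarrow> emeasure (cramer_sequence C0 P X n) ((+) x ` C x) \<le> ennreal (exp (real n * b x))"
    using loc by metis
  define U where "U x = (+) x ` C x" for x
  have "\<exists>J. finite J \<and> J \<subseteq> L \<and> L \<subseteq> (\<Union>x\<in>J. U x)"
  proof -
    have "x \<in> U x" if "x \<in> L" for x
      unfolding U_def using C0_zero[OF abC(2)[OF that]] by (auto intro!: image_eqI[of _ _ 0])
    then have "L \<subseteq> \<Union>(U ` L)" by blast
    moreover have "\<forall>V\<in>U ` L. openin (mlcs_topology C0) V"
      unfolding U_def using openin_translate[OF abC(2)] by blast
    ultimately obtain \<F> where "finite \<F>" "\<F> \<subseteq> U ` L" "L \<subseteq> \<Union>\<F>"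
      using L(1) unfolding compactin_def by meson
    then show ?thesis using finite_subset_image[of \<F> U L] by metis
  qed
  then obtain J where J: "finite J" "J \<subseteq> L" "L \<subseteq> (\<Union>x\<in>J. U x)" by blast
  have U_sets: "U x \<in> sets F" if "x \<in> J" for x
    unfolding U_def using J(2) that abC(2) by (intro sets_translate) auto
  \<comment> \<open>The cover does not depend on \<open>N\<close>, so neither does the factor
    \<open>card J\<close>; along \<open>N = q * n\<close> it is removed by taking powers.\<close>
  have cover: "(\<integral>\<^sup>+\<omega>. g N (block 0 N \<omega>) \<partial>P) \<le> ennreal (real (card J) * exp (real N * r))" if N: "1 \<le> N" for N
  proof -
    have "(\<integral>\<^sup>+\<omega>. g N (block 0 N \<omega>) \<partial>P)
      \<le> (\<integral>\<^sup>+\<omega>. (\<Sum>x\<in>J. ennreal (exp (real N * a x)) * indicator {\<omega>\<in>space P. sample_mean X N \<omega> \<in> U x} \<omega>) \<partial>P)"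
    proof (rule nn_integral_mono)
      fix \<omega> assume \<omega>: "\<omega> \<in> space P"
      let ?S = "\<Sum>x\<in>J. ennreal (exp (real N * a x)) * indicator {\<omega>\<in>space P. sample_mean X N \<omega> \<in> U x} \<omega>"
      show "g N (block 0 N \<omega>) \<le> ?S"
      proof (cases "sample_mean X N \<omega> \<in> W")
        case True
        then have WD: "sample_mean X N \<omega> \<in> W \<inter> D" using sample_mean_in[OF N \<omega>] by simp
        then obtain x where x: "x \<in> J" "sample_mean X N \<omega> \<in> U x" using L(2) J(3) by blast
        have "f (sample_mean X N \<omega>) \<le> ereal (a x)" using abC(3)[of x] x J(2) WD by (auto simp: U_def)
        then have "ereal (real N) * f (sample_mean X N \<omega>) \<le> ereal (real N) * ereal (a x)"
          by (intro ereal_mult_left_mono) auto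
        from exp_ereal_mono[OF this] have "g N (block 0 N \<omega>) \<le> ennreal (exp (real N * a x))"
          using True by (simp add: g_mean)
        also have "\<dots> = ennreal (exp (real N * a x)) * indicator {\<omega>\<in>space P. sample_mean X N \<omega> \<in> U x} \<omega>"
          using x(2) \<omega> by simp
        also have "\<dots> \<le> ?S" by (rule member_le_sum[OF x(1) _ J(1)]) simp
        finally show ?thesis .
      qed (simp add: g_mean)
    qed
    also have "\<dots> = (\<Sum>x\<in>J. ennreal (exp (real N * a x)) * emeasure (cramer_sequence C0 P X N) (U x))"
    proof -
      have ev: "{\<omega>\<in>space P. sample_mean X N \<omega> \<in> U x} \<in> events" if "x \<in> J" for x
        using measurable_sets[OF measurable_sample_mean U_sets[OF that], of N]
        by (simp add: vimage_def Int_def conj_commute)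
      show ?thesis
        using ev by (subst nn_integral_sum)
          (auto intro!: sum.cong simp: nn_integral_cmult_indicator emeasure_cramer[OF U_sets])
    qed
    also have "\<dots> \<le> (\<Sum>x\<in>J. ennreal (exp (real N * r)))"
    proof (rule sum_mono)
      fix x assume "x \<in> J"
      then have x: "x \<in> L" using J(2) by blast
      have "ennreal (exp (real N * a x)) * emeasure (cramer_sequence C0 P X N) (U x)
          \<le> ennreal (exp (real N * a x)) * ennreal (exp (real N * b x))"
        unfolding U_def using abC(4)[OF x N] by (intro mult_left_mono) auto
      also have "\<dots> = ennreal (exp (real N * (a x + b x)))"
        by (simp add: ennreal_mult'[symmetric] exp_add[symmetric] distrib_left)
      also have "\<dots> \<le> ennreal (exp (real N * r))"
        using abC(1)[OF x] by (intro ennreal_leI) (simp add: mult_left_mono)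
      finally show "ennreal (exp (real N * a x)) * emeasure (cramer_sequence C0 P X N) (U x)
          \<le> ennreal (exp (real N * r))" .
    qed
    also have "\<dots> = ennreal (real (card J) * exp (real N * r))"
      by (simp add: ennreal_mult' ennreal_of_nat_eq_real_of_nat)
    finally show ?thesis .
  qed
  have "(\<integral>\<^sup>+\<omega>. g n (block 0 n \<omega>) \<partial>P) \<le> ennreal (exp (real n * r))"
  proof (rule ennreal_le_of_powers)
    fix q :: nat assume q: "1 \<le> q"
    then have "1 \<le> q * n" using n by (simp add: Suc_le_eq)
    from order_trans[OF super[OF q] cover[OF this]]
    show "(\<integral>\<^sup>+\<omega>. g n (block 0 n \<omega>) \<partial>P) ^ q \<le> ennreal (real (card J) * exp (real n * r) ^ q)"
      by (simp add: exp_of_nat_mult[symmetric] mult.assoc)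
  qed simp
  then show ?thesis by (simp add: g_mean)
qed

text \<open>Convexity passes tightness from \<open>\<mu>\<close> to the law of the mean: if all
  \<open>n\<close> vectors lie in the convex set \<open>K m \<inter> D\<close>, so does their mean,
  and the union bound costs only the factor \<open>n\<close>.\<close>

lemma prob_sample_mean_tendsto:
  assumes K: "\<And>m. K m \<in> sets F" "\<And>m. convex (K m \<inter> D)"
    and lim: "(\<lambda>m. measure \<mu> (K m)) \<longlonglongrightarrow> 1" and n: "1 \<le> n"
  shows "(\<lambda>m. prob {\<omega> \<in> space P. sample_mean X n \<omega> \<in> K m}) \<longlonglongrightarrow> 1"
proof -
  have X_ev: "{\<omega> \<in> space P. X i \<omega> \<in> K m} \<in> events" if "1 \<le> i" for i m
    using measurable_sets[OF measurable_X[OF that] K(1)] by (simp add: vimage_def Int_def conj_commute)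
  have mean_ev: "{\<omega> \<in> space P. sample_mean X n \<omega> \<in> K m} \<in> events" for m
    using measurable_sets[OF measurable_sample_mean K(1)] by (simp add: vimage_def Int_def conj_commute)
  have "1 - real n * (1 - measure \<mu> (K m)) \<le> prob {\<omega> \<in> space P. sample_mean X n \<omega> \<in> K m}" for m
  proof -
    let ?N = "\<lambda>i. space P - {\<omega> \<in> space P. X i \<omega> \<in> K m}"
    have N: "?N i \<in> events" "prob (?N i) = 1 - measure \<mu> (K m)" if "i \<in> {1..n}" for i
    proof -
      have i: "1 \<le> i" using that by simp
      have "measure \<mu> (K m) = prob {\<omega> \<in> space P. X i \<omega> \<in> K m}"
        unfolding law[OF i, symmetric] using measure_distr[OF measurable_X[OF i] K(1)]
        by (simp add: vimage_def Int_def conj_commute)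
      then show "?N i \<in> events" "prob (?N i) = 1 - measure \<mu> (K m)"
        using X_ev[OF i] prob_compl[OF X_ev[OF i]] by auto
    qed
    have "1 - prob {\<omega> \<in> space P. sample_mean X n \<omega> \<in> K m}
        = prob (space P - {\<omega> \<in> space P. sample_mean X n \<omega> \<in> K m})"
      using prob_compl[OF mean_ev] by simp
    also have "\<dots> \<le> prob (\<Union>i\<in>{1..n}. ?N i)"
    proof (rule finite_measure_mono)
      show "space P - {\<omega> \<in> space P. sample_mean X n \<omega> \<in> K m} \<subseteq> (\<Union>i\<in>{1..n}. ?N i)"
      proof (rule ccontr)
        assume "\<not> ?thesis"
        then obtain \<omega> where \<omega>: "\<omega> \<in> space P" "sample_mean X n \<omega> \<notin> K m" "\<And>i. i \<in> {1..n} \<Longrightarrow> X i \<omega> \<in> K m"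
          by blast
        have "(\<Sum>i\<in>{1..n}. (1 / real n) *\<^sub>R X i \<omega>) \<in> K m \<inter> D"
          using \<omega> X_in n by (intro convex_sum K(2)) auto
        then show False using \<omega>(2) by (simp add: sample_mean_def scaleR_sum_right)
      qed
      show "(\<Union>i\<in>{1..n}. ?N i) \<in> events" using N(1) by (intro sets.finite_UN) auto
    qed
    also have "\<dots> \<le> (\<Sum>i\<in>{1..n}. prob (?N i))"
      using N(1) by (intro finite_measure_subadditive_finite) auto
    also have "\<dots> = real n * (1 - measure \<mu> (K m))" using N(2) by simp
    finally show ?thesis by linarith
  qed
  moreover have "(\<lambda>m. 1 - real n * (1 - measure \<mu> (K m))) \<longlonglongrightarrow> 1 - real n * (1 - 1)"
    using lim by (intro tendsto_intros)
  then have "(\<lambda>m. 1 - real n * (1 - measure \<mu> (K m))) \<longlonglongrightarrow> 1" by simp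
  ultimately show ?thesis
    using tendsto_sandwich[OF _ _ _ tendsto_const] prob_le_1 by (metis (no_types, lifting) always_eventually)
qed

text \<open>The convex set \<open>B\<close> is the whole space for the bound with the hull and a
  contraction of \<open>dom f\<close> for the other one. The compact case is applied to
  \<open>K m \<inter> B\<close>, whose trace on \<open>D\<close> is again convex.\<close>

lemma cramer_bound_convex:
  assumes tight: "convex_tight_on C0 \<mu> D" "sets \<mu> = sets F"
    and f: "f \<in> borel_measurable F" "concave_ext_on D f"
    and B: "B \<in> sets F" "convex B"
    and loc: "\<And>x. \<exists>a b C. a + b \<le> r \<and> C \<in> C0 \<and> (\<forall>y\<in>B \<inter> D \<inter> (+) x ` C. f y \<le> ereal a) \<and>
      (\<forall>n\<ge>1. emeasure (cramer_sequence C0 P X n) ((+) x ` C) \<le> ennreal (exp (real n * b)))"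
    and n: "1 \<le> n"
  shows "(\<integral>\<^sup>+\<omega>. exp_ereal (ereal (real n) * f (sample_mean X n \<omega>)) * indicator B (sample_mean X n \<omega>) \<partial>P)
    \<le> ennreal (exp (real n * r))"
proof -
  obtain K where K: "\<And>m. K m \<in> sets F" "\<And>m. convex (K m \<inter> D)"
    "\<And>m. \<exists>L. compactin (mlcs_topology C0) L \<and> K m \<inter> D \<subseteq> L" "(\<lambda>m. measure \<mu> (K m)) \<longlonglongrightarrow> 1"
    using tight unfolding convex_tight_on_def by metis
  show ?thesis
  proof (rule nn_integral_le_of_large_events[OF _ _ prob_sample_mean_tendsto[OF K(1,2,4) n]])
    note [measurable] = f(1) B(1)
    show "(\<lambda>\<omega>. exp_ereal (ereal (real n) * f (sample_mean X n \<omega>)) * indicator B (sample_mean X n \<omega>))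
        \<in> borel_measurable P" by measurable
    fix m
    show "{\<omega> \<in> space P. sample_mean X n \<omega> \<in> K m} \<in> events"
      using measurable_sets[OF measurable_sample_mean K(1)] by (simp add: vimage_def Int_def conj_commute)
    obtain L where L: "compactin (mlcs_topology C0) L" "K m \<inter> D \<subseteq> L" using K(3) by blast
    have "(\<integral>\<^sup>+\<omega>. exp_ereal (ereal (real n) * f (sample_mean X n \<omega>)) * indicator (K m \<inter> B) (sample_mean X n \<omega>) \<partial>P)
        \<le> ennreal (exp (real n * r))"
    proof (rule cramer_bound_compact[OF f _ _ L(1) _ _ n])
      have "K m \<inter> B \<inter> D = (K m \<inter> D) \<inter> B" by blast
      then show "convex (K m \<inter> B \<inter> D)" using convex_Int[OF K(2) B(2)] by simp
      show "K m \<inter> B \<in> sets F" using K(1) B(1) by blast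
      show "K m \<inter> B \<inter> D \<subseteq> L" using L(2) by blast
      fix x
      obtain a b C where "a + b \<le> r" "C \<in> C0" "\<forall>y\<in>B \<inter> D \<inter> (+) x ` C. f y \<le> ereal a"
        "\<forall>n\<ge>1. emeasure (cramer_sequence C0 P X n) ((+) x ` C) \<le> ennreal (exp (real n * b))"
        using loc[of x] by blast
      then show "\<exists>a b C. a + b \<le> r \<and> C \<in> C0 \<and> (\<forall>y\<in>K m \<inter> B \<inter> D \<inter> (+) x ` C. f y \<le> ereal a) \<and>
        (\<forall>n\<ge>1. emeasure (cramer_sequence C0 P X n) ((+) x ` C) \<le> ennreal (exp (real n * b)))"
        by (intro exI[of _ a] exI[of _ b] exI[of _ C]) blast
    qed
    also have "(\<integral>\<^sup>+\<omega>. exp_ereal (ereal (real n) * f (sample_mean X n \<omega>)) * indicator (K m \<inter> B) (sample_mean X n \<omega>) \<partial>P)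
      = (\<integral>\<^sup>+\<omega>. exp_ereal (ereal (real n) * f (sample_mean X n \<omega>)) * indicator B (sample_mean X n \<omega>) *
          indicator {\<omega> \<in> space P. sample_mean X n \<omega> \<in> K m} \<omega> \<partial>P)"
      by (intro nn_integral_cong) (auto simp: indicator_def)
    finally show "(\<integral>\<^sup>+\<omega>. exp_ereal (ereal (real n) * f (sample_mean X n \<omega>)) * indicator B (sample_mean X n \<omega>) *
          indicator {\<omega> \<in> space P. sample_mean X n \<omega> \<in> K m} \<omega> \<partial>P) \<le> ennreal (exp (real n * r))" .
  qed
qed

lemma entropy_le_imp_exp_bound:
  assumes "entropy_of C0 (cramer_sequence C0 P X) x < ereal b"
  shows "\<exists>C\<in>C0. \<forall>n\<ge>1. emeasure (cramer_sequence C0 P X n) ((+) x ` C) \<le> ennreal (exp (real n * b))"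
proof -
  obtain C where "C \<in> C0" "liminf (\<lambda>n. ereal (1 / real n) *
      log_ennreal (emeasure (cramer_sequence C0 P X n) ((+) x ` C))) < ereal b"
    using assms unfolding entropy_of_def convex_nhds_def by (auto simp: INF_less_iff)
  then show ?thesis using emeasure_cramer_le_exp by blast
qed

text \<open>Here \<open>u\<close> stands for the value at \<open>x\<close> of an upper
  semicontinuous majorant, or of \<open>f\<close> itself. The neighbourhoods for \<open>f\<close>
  and for the rate are found separately and intersected.\<close>

lemma local_bound:
  assumes sum: "u + entropy_of C0 (cramer_sequence C0 P X) x < ereal r"
    and u: "\<And>a. u < ereal a \<Longrightarrow> \<exists>C\<in>C0. \<forall>y\<in>B \<inter> (+) x ` C. f y \<le> ereal a"
  shows "\<exists>a b C. a + b \<le> r \<and> C \<in> C0 \<and> (\<forall>y\<in>B \<inter> (+) x ` C. f y \<le> ereal a) \<and>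
      (\<forall>n\<ge>1. emeasure (cramer_sequence C0 P X n) ((+) x ` C) \<le> ennreal (exp (real n * b)))"
proof -
  obtain a b where ab: "u < ereal a" "entropy_of C0 (cramer_sequence C0 P X) x < ereal b" "a + b \<le> r"
    using ereal_split_less[OF sum] by blast
  obtain C1 where C1: "C1 \<in> C0" "\<forall>y\<in>B \<inter> (+) x ` C1. f y \<le> ereal a" using u[OF ab(1)] by blast
  obtain C2 where C2: "C2 \<in> C0"
    "\<And>n. 1 \<le> n \<Longrightarrow> emeasure (cramer_sequence C0 P X n) ((+) x ` C2) \<le> ennreal (exp (real n * b))"
    using entropy_le_imp_exp_bound[OF ab(2)] by blast
  have "emeasure (cramer_sequence C0 P X n) ((+) x ` (C1 \<inter> C2)) \<le> ennreal (exp (real n * b))" if "1 \<le> n" for n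
  proof -
    have "emeasure (cramer_sequence C0 P X n) ((+) x ` (C1 \<inter> C2)) \<le> emeasure (cramer_sequence C0 P X n) ((+) x ` C2)"
      using sets_translate[OF C2(1)] by (intro emeasure_mono) (auto simp: cramer_sequence_def)
    then show ?thesis using C2(2)[OF that] by (rule order_trans)
  qed
  moreover have "C1 \<inter> C2 \<in> C0" using C0_Int C1(1) C2(1) by blast
  ultimately show ?thesis using ab(3) C1(2) by (intro exI[of _ a] exI[of _ b] exI[of _ "C1 \<inter> C2"]) blast
qed

text \<open>The condition on \<open>f\<close> is vacuous, so \<open>a = r\<close> is free and the
  trivial rate \<open>b = 0\<close> of a probability suffices.\<close>

lemma local_bound_avoiding:
  assumes C: "C \<in> C0" and "B \<inter> (+) x ` C = {}"
  shows "\<exists>a b C. a + b \<le> r \<and> C \<in> C0 \<and> (\<forall>y\<in>B \<inter> (+) x ` C. f y \<le> ereal a) \<and>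
      (\<forall>n\<ge>1. emeasure (cramer_sequence C0 P X n) ((+) x ` C) \<le> ennreal (exp (real n * b)))"
  using assms emeasure_cramer_translate[OF C]
  by (intro exI[of _ r] exI[of _ 0] exI[of _ C]) auto

text \<open>Measurability on \<open>D\<close> is enough: the means take values in \<open>D\<close>,
  so a measurable extension has the same integrals, and it stays concave on \<open>D\<close> because
  \<open>D\<close> is convex.\<close>

lemma cramer_bound_local:
  assumes tight: "convex_tight_on C0 \<mu> D" "sets \<mu> = sets F"
    and f: "f \<in> borel_measurable (restrict_space F D)" "concave_ext_on D f"
    and B: "B \<in> sets F" "convex B"
    and loc: "\<And>x. \<exists>a b C. a + b \<le> r \<and> C \<in> C0 \<and> (\<forall>y\<in>B \<inter> D \<inter> (+) x ` C. f y \<le> ereal a) \<and>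
      (\<forall>n\<ge>1. emeasure (cramer_sequence C0 P X n) ((+) x ` C) \<le> ennreal (exp (real n * b)))"
    and n: "1 \<le> n"
  shows "(\<integral>\<^sup>+\<omega>. exp_ereal (ereal (real n) * f (sample_mean X n \<omega>)) * indicator B (sample_mean X n \<omega>) \<partial>P)
    \<le> ennreal (exp (real n * r))"
proof -
  obtain g where g: "g \<in> borel_measurable F" "\<And>x. x \<in> D \<Longrightarrow> g x = f x"
    using borel_measurable_ereal_extension[OF f(1)] by auto
  have "concave_ext_on D g"
    using f(2) g(2) convex_D unfolding concave_ext_on_def by (simp add: convex_alt convexD)
  moreover have "\<exists>a b C. a + b \<le> r \<and> C \<in> C0 \<and> (\<forall>y\<in>B \<inter> D \<inter> (+) x ` C. g y \<le> ereal a) \<and>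
      (\<forall>n\<ge>1. emeasure (cramer_sequence C0 P X n) ((+) x ` C) \<le> ennreal (exp (real n * b)))" for x
    using loc[of x] g(2) by (metis (no_types, lifting) IntD1 IntD2)
  ultimately have "(\<integral>\<^sup>+\<omega>. exp_ereal (ereal (real n) * g (sample_mean X n \<omega>)) * indicator B (sample_mean X n \<omega>) \<partial>P)
    \<le> ennreal (exp (real n * r))"
    by (intro cramer_bound_convex[OF tight g(1) _ B _ n])
  moreover have "(\<integral>\<^sup>+\<omega>. exp_ereal (ereal (real n) * g (sample_mean X n \<omega>)) * indicator B (sample_mean X n \<omega>) \<partial>P)
      = (\<integral>\<^sup>+\<omega>. exp_ereal (ereal (real n) * f (sample_mean X n \<omega>)) * indicator B (sample_mean X n \<omega>) \<partial>P)"
    using g(2) sample_mean_in[OF n] by (intro nn_integral_cong) simp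
  ultimately show ?thesis by simp
qed

lemma cramer_bound_usc_hull:
  assumes tight: "convex_tight_on C0 \<mu> D" "sets \<mu> = sets F"
    and f: "f \<in> borel_measurable (restrict_space F D)" "concave_ext_on D f"
    and g: "usc (mlcs_topology C0) g" "f \<le> g"
    and less: "\<And>x. g x + entropy_of C0 (cramer_sequence C0 P X) x < ereal r"
    and n: "1 \<le> n"
  shows "(\<integral>\<^sup>+\<omega>. exp_ereal (ereal (real n) * f (sample_mean X n \<omega>)) \<partial>P) \<le> ennreal (exp (real n * r))"
proof -
  have "\<exists>a b C. a + b \<le> r \<and> C \<in> C0 \<and> (\<forall>y\<in>UNIV \<inter> D \<inter> (+) x ` C. f y \<le> ereal a) \<and>
      (\<forall>n\<ge>1. emeasure (cramer_sequence C0 P X n) ((+) x ` C) \<le> ennreal (exp (real n * b)))" for x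
  proof (rule local_bound[OF less[of x]])
    fix a assume "g x < ereal a"
    moreover have "openin (mlcs_topology C0) {y. g y < ereal a}" using g(1) by (simp add: usc_def)
    ultimately obtain C where C: "C \<in> C0" "(+) x ` C \<subseteq> {y. g y < ereal a}"
      unfolding openin_mlcs_iff by blast
    have "f y \<le> ereal a" if "y \<in> (+) x ` C" for y
      using le_funD[OF g(2), of y] C(2) that by (auto intro: order_trans less_imp_le)
    with C(1) show "\<exists>C\<in>C0. \<forall>y\<in>UNIV \<inter> D \<inter> (+) x ` C. f y \<le> ereal a" by blast
  qed
  moreover have "UNIV \<in> sets F" using sets.top[of F] by simp
  ultimately show ?thesis using cramer_bound_local[OF tight f, of UNIV r n] n by simp
qed

text \<open>On the boundary of \<open>dom f\<close> nothing is known about \<open>f\<close>, so \<open>dom f\<close> is exhausted by its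
  contractions towards one of its points; the closures of these stay inside \<open>dom f\<close>.\<close>

lemma cramer_bound_open_dom:
  assumes tight: "convex_tight_on C0 \<mu> D" "sets \<mu> = sets F"
    and f: "f \<in> borel_measurable (restrict_space F D)" "concave_ext_on D f"
    and dom: "openin (mlcs_topology C0) (finite_dom f)" "convex (finite_dom f)"
    and usc: "usc (subtopology (mlcs_topology C0) (finite_dom f \<inter> mlcs_topology C0 closure_of D)) f"
    and less: "\<And>x. f x + entropy_of C0 (cramer_sequence C0 P X) x < ereal r"
    and n: "1 \<le> n"
  shows "(\<integral>\<^sup>+\<omega>. exp_ereal (ereal (real n) * f (sample_mean X n \<omega>)) \<partial>P) \<le> ennreal (exp (real n * r))"
proof -
  define V where "V = finite_dom f"
  define h where "h \<omega> = exp_ereal (ereal (real n) * f (sample_mean X n \<omega>))" for \<omega>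
  \<comment> \<open>Under the addition convention a value \<open>\<infinity>\<close> would make the
    sum infinite. Hence \<open>f\<close> is \<open>-\<infinity>\<close> off \<open>V\<close> and the
    integrand vanishes there.\<close>
  have "f x \<noteq> \<infinity>" for x using less[of x] by auto
  then have outside: "f x = -\<infinity>" if "x \<notin> V" for x using that by (auto simp: V_def finite_dom_def)
  have h_outside: "h \<omega> = 0" if "sample_mean X n \<omega> \<notin> V" for \<omega>
    using outside[OF that] n by (simp add: h_def)
  show ?thesis
  proof (cases "V = {}")
    case True
    then show ?thesis using h_outside unfolding h_def by simp
  next
    case False
    then obtain x0 where x0: "x0 \<in> V" by blast
    obtain C where C: "C \<in> C0" "(+) x0 ` C \<subseteq> V"
      using dom(1) x0 unfolding openin_mlcs_iff V_def by blast
    define t where "t j = 1 / (real j + 2)" for j :: nat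
    have t: "0 < t j" for j by (simp add: t_def)
    \<comment> \<open>This is the image of \<open>V\<close> under the contraction by
      \<open>1 / (1 + t j)\<close> towards \<open>x0\<close>, written as a preimage so that
      measurability is immediate.\<close>
    define B where "B j = {z. (1 + t j) *\<^sub>R z + (- t j) *\<^sub>R x0 \<in> V}" for j
    have B_sets: "B j \<in> sets F" for j
      using measurable_sets[OF measurable_affine sets_open_convex[OF dom], of "1 + t j" "(- t j) *\<^sub>R x0"]
      by (simp add: B_def vimage_def V_def)
    have B_convex: "convex (B j)" for j
    proof (rule convexI)
      fix y z :: 'a and u v :: real
      assume yz: "y \<in> B j" "z \<in> B j" and uv: "0 \<le> u" "0 \<le> v" "u + v = 1"
      have "u *\<^sub>R ((1 + t j) *\<^sub>R y + (- t j) *\<^sub>R x0) + v *\<^sub>R ((1 + t j) *\<^sub>R z + (- t j) *\<^sub>R x0) \<in> V"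
        using yz unfolding B_def V_def mem_Collect_eq by (intro convexD[OF dom(2) _ _ uv])
      moreover have "u *\<^sub>R ((1 + t j) *\<^sub>R y + (- t j) *\<^sub>R x0) + v *\<^sub>R ((1 + t j) *\<^sub>R z + (- t j) *\<^sub>R x0)
          = (1 + t j) *\<^sub>R (u *\<^sub>R y + v *\<^sub>R z) + (u + v) *\<^sub>R ((- t j) *\<^sub>R x0)"
        by (simp only: scaleR_add_right scaleR_add_left scaleR_left_commute ac_simps)
      ultimately show "u *\<^sub>R y + v *\<^sub>R z \<in> B j" using uv(3) by (simp add: B_def)
    qed
    \<comment> \<open>A point of \<open>B j\<close> is a convex combination of a point of
      \<open>V\<close> and \<open>x0\<close> with weight \<open>s\<close> on the latter; replacing
      \<open>x0\<close> by \<open>x0 + c\<close> shifts it by \<open>s c\<close>. So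
      \<open>B j\<close> keeps a uniform margin inside \<open>V\<close>.\<close>
    have fat: "z + s *\<^sub>R c \<in> V" if z: "z \<in> B j" and c: "c \<in> C" and s: "s = t j / (1 + t j)" for z c s j
    proof -
      have "(1 / (1 + t j)) *\<^sub>R ((1 + t j) *\<^sub>R z + (- t j) *\<^sub>R x0) + s *\<^sub>R (x0 + c) \<in> V"
      proof -
        have "x0 + c \<in> V" using C(2) c by blast
        moreover have "1 / (1 + t j) + s = 1" "0 \<le> 1 / (1 + t j)" "0 \<le> s"
          unfolding s using t[of j] by (auto simp: add_divide_distrib[symmetric])
        moreover have "(1 + t j) *\<^sub>R z + (- t j) *\<^sub>R x0 \<in> V" using z by (simp add: B_def)
        moreover have "convex V" using dom(2) by (simp add: V_def)
        ultimately show ?thesis unfolding convex_def by blast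
      qed
      moreover have "(1 / (1 + t j)) *\<^sub>R ((1 + t j) *\<^sub>R z + (- t j) *\<^sub>R x0) = z - s *\<^sub>R x0"
        unfolding s using t[of j] by (simp add: scaleR_add_right scaleR_diff_right)
      ultimately show ?thesis by (simp add: scaleR_add_right)
    qed
    have B_sub: "B j \<subseteq> V" for j using fat[OF _ C0_zero[OF C(1)]] by fastforce
    have bound: "(\<integral>\<^sup>+\<omega>. h \<omega> * indicator (B j) (sample_mean X n \<omega>) \<partial>P) \<le> ennreal (exp (real n * r))" for j
      unfolding h_def
    proof (rule cramer_bound_local[OF tight f B_sets B_convex _ n])
      fix x
      \<comment> \<open>In the first two cases some neighbourhood of \<open>x\<close> misses
        \<open>B j \<inter> D\<close>: by the margin of \<open>B j\<close>, or by the definition of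
        closure. Semicontinuity is needed only in the third.\<close>
      consider "x \<notin> V" | "x \<notin> mlcs_topology C0 closure_of D" | "x \<in> V \<inter> mlcs_topology C0 closure_of D"
        by blast
      then show "\<exists>a b C. a + b \<le> r \<and> C \<in> C0 \<and> (\<forall>y\<in>B j \<inter> D \<inter> (+) x ` C. f y \<le> ereal a) \<and>
        (\<forall>n\<ge>1. emeasure (cramer_sequence C0 P X n) ((+) x ` C) \<le> ennreal (exp (real n * b)))"
      proof cases
        case 1
        define s where "s = t j / (1 + t j)"
        have "s \<noteq> 0" using t[of j] by (simp add: s_def)
        show ?thesis
        proof (rule local_bound_avoiding[OF C0_dilation[OF C(1) \<open>s \<noteq> 0\<close>]])
          have "y \<notin> B j" if yx: "y - x \<in> (*\<^sub>R) s ` C" for y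
          proof
            assume y: "y \<in> B j"
            obtain c where c: "c \<in> C" "- (y - x) = s *\<^sub>R c"
              using C0_dilate_minus[OF C(1) yx] by blast
            have "y + s *\<^sub>R c = x" unfolding c(2)[symmetric] by simp
            with fat[OF y c(1) s_def] 1 show False by simp
          qed
          then show "B j \<inter> D \<inter> (+) x ` (*\<^sub>R) s ` C = {}" unfolding set_eq_iff Int_iff translate_mem_iff by blast
        qed
      next
        case 2
        then obtain U where U: "x \<in> U" "openin (mlcs_topology C0) U" "U \<inter> D = {}"
          unfolding in_closure_of by auto
        then obtain C' where C': "C' \<in> C0" "(+) x ` C' \<subseteq> U" unfolding openin_mlcs_iff by blast
        then show ?thesis using U(3) by (intro local_bound_avoiding[OF C'(1)]) blast
      next
        case 3
        show ?thesis
        proof (rule local_bound[OF less[of x]])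
          fix a assume a: "f x < ereal a"
          let ?S = "V \<inter> mlcs_topology C0 closure_of D"
          have "openin (subtopology (mlcs_topology C0) ?S) {y \<in> ?S. f y < ereal a}"
            using usc by (simp add: usc_def V_def)
          then obtain T where T: "openin (mlcs_topology C0) T" "{y \<in> ?S. f y < ereal a} = T \<inter> ?S"
            unfolding openin_subtopology by blast
          have "x \<in> T" using T(2) a 3 by blast
          then obtain C' where C': "C' \<in> C0" "(+) x ` C' \<subseteq> T" using T(1) unfolding openin_mlcs_iff by blast
          have "D \<subseteq> mlcs_topology C0 closure_of D" by (rule closure_of_subset) simp
          then have "f y \<le> ereal a" if "y \<in> B j \<inter> D \<inter> (+) x ` C'" for y
            using that B_sub[of j] C'(2) T(2) by (auto intro!: less_imp_le)
          with C'(1) show "\<exists>C\<in>C0. \<forall>y\<in>B j \<inter> D \<inter> (+) x ` C. f y \<le> ereal a" by blast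
        qed
      qed
    qed
    have B_mono: "B i \<subseteq> B j" if "i \<le> j" for i j
    proof
      fix z assume z: "z \<in> B i"
      have tt: "t j \<le> t i" using that unfolding t_def by (intro divide_left_mono) auto
      define l where "l = t j / t i"
      have l: "0 \<le> l" "l \<le> 1" "l * t i = t j" using t[of i] t[of j] tt by (auto simp: l_def)
      \<comment> \<open>Pushing \<open>z\<close> away from \<open>x0\<close> by the smaller amount
        \<open>t j\<close> ends on the segment from \<open>z\<close> to the point pushed by
        \<open>t i\<close>; both ends lie in \<open>V\<close>.\<close>
      have "l *\<^sub>R ((1 + t i) *\<^sub>R z + (- t i) *\<^sub>R x0) + (1 - l) *\<^sub>R z \<in> V"
      proof -
        have "z \<in> V" using z B_sub by blast
        moreover have "(1 + t i) *\<^sub>R z + (- t i) *\<^sub>R x0 \<in> V" using z by (simp add: B_def)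
        moreover have "convex V" using dom(2) by (simp add: V_def)
        moreover have "0 \<le> 1 - l" "l + (1 - l) = 1" using l by auto
        ultimately show ?thesis using l(1) unfolding convex_def by blast
      qed
      moreover have "l *\<^sub>R ((1 + t i) *\<^sub>R z + (- t i) *\<^sub>R x0) + (1 - l) *\<^sub>R z
          = (1 + l * t i) *\<^sub>R z + (- (l * t i)) *\<^sub>R x0"
        by (simp add: algebra_simps)
      ultimately show "z \<in> B j" by (simp add: B_def l(3))
    qed
    have B_Union: "\<exists>j. z \<in> B j" if z: "z \<in> V" for z
    proof -
      obtain e where e: "0 < e" "\<And>u. 0 \<le> u \<Longrightarrow> u \<le> e \<Longrightarrow> z + u *\<^sub>R (z - x0) \<in> V"
        using open_segment_extend[OF dom(1), of z "z - x0"] z by (auto simp: V_def)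
      obtain j where "t j < e" unfolding t_def using archimedean_step[OF e(1)] by blast
      then have "z + t j *\<^sub>R (z - x0) \<in> V" using e(2) t[of j] by simp
      moreover have "z + t j *\<^sub>R (z - x0) = (1 + t j) *\<^sub>R z + (- t j) *\<^sub>R x0"
        by (simp add: algebra_simps)
      ultimately show ?thesis by (auto simp: B_def)
    qed
    have h_SUP: "h \<omega> = (SUP j. h \<omega> * indicator (B j) (sample_mean X n \<omega>))" for \<omega>
    proof (cases "sample_mean X n \<omega> \<in> V")
      case True
      then obtain j where "sample_mean X n \<omega> \<in> B j" using B_Union by blast
      then show ?thesis
        by (intro antisym SUP_upper2[of j] SUP_least) (auto simp: indicator_def)
    qed (simp add: h_outside)
    have h_meas: "h \<in> borel_measurable P"
    proof -
      have "sample_mean X n \<in> measurable P (restrict_space F D)"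
        using sample_mean_in[OF n] by (intro measurable_restrict_space2) auto
      from measurable_compose[OF this f(1)] show ?thesis unfolding h_def[abs_def] by measurable
    qed
    note [measurable] = h_meas B_sets
    have "(\<integral>\<^sup>+\<omega>. h \<omega> \<partial>P) = (\<integral>\<^sup>+\<omega>. (SUP j. h \<omega> * indicator (B j) (sample_mean X n \<omega>)) \<partial>P)"
      using h_SUP by simp
    also have "\<dots> = (SUP j. \<integral>\<^sup>+\<omega>. h \<omega> * indicator (B j) (sample_mean X n \<omega>) \<partial>P)"
    proof (rule nn_integral_monotone_convergence_SUP)
      show "incseq (\<lambda>j \<omega>. h \<omega> * indicator (B j) (sample_mean X n \<omega>))"
        unfolding incseq_def le_fun_def using B_mono
        by (intro allI impI mult_left_mono) (auto simp: indicator_def)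
      show "(\<lambda>\<omega>. h \<omega> * indicator (B j) (sample_mean X n \<omega>)) \<in> borel_measurable P" for j
        by measurable
    qed
    also have "\<dots> \<le> ennreal (exp (real n * r))" using bound by (intro SUP_least)
    finally show ?thesis unfolding h_def .
  qed
qed

end

section \<open>Upper semicontinuous hulls and the conclusion\<close>

lemma usc_usc_hull:
  assumes "topspace T = UNIV"
  shows "usc T (usc_hull T f)"
proof -
  have "{x. usc_hull T f x < t} = (\<Union>g\<in>{g. usc T g \<and> f \<le> g}. {x. g x < t})" for t
    unfolding usc_hull_eq_INF[OF assms] by (auto simp: INF_less_iff)
  then show ?thesis using assms by (auto simp: usc_def)
qed

lemma le_usc_hull: "topspace T = UNIV \<Longrightarrow> f \<le> usc_hull T f"
  unfolding usc_hull_eq_INF by (rule INF_greatest) auto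

text \<open>Reduces a comparison with a possibly infinite supremum to real numbers strictly above
  it; when the supremum is \<open>\<infinity>\<close> there are none and nothing is to be
  shown.\<close>

lemma ereal_le_of_real_bounds:
  fixes x y :: ereal
  assumes "\<And>r. y < ereal r \<Longrightarrow> x \<le> ereal r"
  shows "x \<le> y"
proof (rule ccontr)
  assume "\<not> x \<le> y"
  then obtain r where "y < ereal r" "ereal r < x" using ereal_dense2[of y x] not_le by blast
  then show False using assms[of r] by simp
qed

theorem mainTheorem4:
  fixes C0 :: "'a::real_vector set set"
    and D :: "'a set"
    and \<mu> :: "'a measure"
    and P :: "'w measure"
    and X :: "nat \<Rightarrow> 'w \<Rightarrow> 'a"
    and f :: "'a \<Rightarrow> ereal"
  defines "\<tau> \<equiv> mlcs_topology C0"
    and "s \<equiv> entropy_of C0 (cramer_sequence C0 P X)"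
  assumes "measurable_lcs C0"
    and "convex D"
    and "prob_space \<mu>" and "sets \<mu> = sets (mlcs_algebra C0)"
    and "carried_by \<mu> D"
    and "convex_tight_on C0 \<mu> D"
    and "iid_sequence C0 P \<mu> D X"
    and "f \<in> borel_measurable (restrict_space (mlcs_algebra C0) D)"
    and "concave_ext_on D f"
  shows "(\<forall>n\<ge>1. ereal (1 / real n) *
              log_ennreal (\<integral>\<^sup>+\<omega>. exp_ereal (ereal (real n) * f (sample_mean X n \<omega>)) \<partial>P)
            \<le> (SUP x. usc_hull \<tau> f x + s x))
       \<and> (openin \<tau> (finite_dom f) \<and> convex (finite_dom f) \<and>
            usc (subtopology \<tau> (finite_dom f \<inter> \<tau> closure_of D)) f \<longrightarrow>
          (\<forall>n\<ge>1. ereal (1 / real n) *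
              log_ennreal (\<integral>\<^sup>+\<omega>. exp_ereal (ereal (real n) * f (sample_mean X n \<omega>)) \<partial>P)
            \<le> (SUP x. f x + s x)))"
proof -
  interpret iid_lcs C0 P X \<mu> D
    using assms unfolding iid_sequence_def iid_lcs_def iid_lcs_axioms_def by blast
  have top: "topspace \<tau> = UNIV" by (simp add: \<tau>_def)
  note tight = \<open>convex_tight_on C0 \<mu> D\<close> \<open>sets \<mu> = sets (mlcs_algebra C0)\<close>
  note f = \<open>f \<in> borel_measurable (restrict_space (mlcs_algebra C0) D)\<close> \<open>concave_ext_on D f\<close>
  let ?I = "\<lambda>n. ereal (1 / real n) *
    log_ennreal (\<integral>\<^sup>+\<omega>. exp_ereal (ereal (real n) * f (sample_mean X n \<omega>)) \<partial>P)"
  have "?I n \<le> (SUP x. usc_hull \<tau> f x + s x)" if n: "1 \<le> n" for n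
  proof (rule ereal_le_of_real_bounds)
    fix r assume r: "(SUP x. usc_hull \<tau> f x + s x) < ereal r"
    have "usc_hull \<tau> f x + s x < ereal r" for x using r by (rule SUP_lessD) simp
    then show "?I n \<le> ereal r"
      using usc_usc_hull[OF top] le_usc_hull[OF top] unfolding \<tau>_def s_def
      by (intro scaled_log_le[OF _ n] cramer_bound_usc_hull[OF tight f _ _ _ n])
  qed
  moreover have "?I n \<le> (SUP x. f x + s x)"
    if dom: "openin \<tau> (finite_dom f)" "convex (finite_dom f)"
      "usc (subtopology \<tau> (finite_dom f \<inter> \<tau> closure_of D)) f" and n: "1 \<le> n" for n
  proof (rule ereal_le_of_real_bounds)
    fix r assume r: "(SUP x. f x + s x) < ereal r"
    have "f x + s x < ereal r" for x using r by (rule SUP_lessD) simp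
    then show "?I n \<le> ereal r"
      using dom unfolding \<tau>_def s_def
      by (intro scaled_log_le[OF _ n] cramer_bound_open_dom[OF tight f _ _ _ _ n])
  qed
  ultimately show ?thesis by blast
qed

end
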